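(* Let $g\sim(a,b,\mu)$ be a Bernstein function with rate function $r=r[g]$. Let $-A$ be the generator of a bounded $C_0$-semigroup $(T(s))_{s\ge0}$ on a Banach space $X$, $M:=\sup_{s\ge0}\|T(s)\|$. Then: (a) for each $x\in\operatorname{dom}(g(A))$ and $y=g(A)x$, $\|\mathcal C_t(A)y\|\le 2M\,r(t)\,\|x\|$ for all $t>0$; (b) if $t\,r(t)\to\infty$ as $t\to\infty$, $g(0+)=0$ and $(T(s))_{s\ge0}$ is mean ergodic, then $\|\mathcal C_t(A)y\|=o(r(t))$ as $t\to\infty$ for every $y\in\operatorname{ran}(g(A))$; (c) if $t\,r(t)=O(1)$ as $t\to\infty$, then $\operatorname{ran}(g(A))\subseteq\operatorname{ran}(A)$ and $\|\mathcal C_t(A)y\|=O(t^{-1})$ as $t\to\infty$ for every $y\in\operatorname{ran}(g(A))$.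
   Context: A Bernstein function $g\sim(a,b,\mu)$ is $g(z)=a+bz+\int_{(0,\infty)}(1-e^{-sz})\mu(\mathrm ds)$ with $a,b\ge0$, $\mu$ positive Radon on $(0,\infty)$, $\int\frac{s}{1+s}\mu(\mathrm ds)<\infty$; $a=g(0+)$. Rate function $r[g](t):=\frac a2+\frac bt+\int_{(0,\infty)}\min(s/t,1)\mu(\mathrm ds)$. The operator $g(A)$ is defined by the extended Hille–Phillips calculus: for $\hat\nu(z)=\int_{[0,\infty)}e^{-sz}\nu(\mathrm ds)$ with $\nu$ a bounded complex measure, $\hat\nu(A)x=\int T(s)x\,\nu(\mathrm ds)$; a holomorphic $f$ on $\{\operatorname{Re}z>0\}$ is given $f(A):=e(A)^{-1}(ef)(A)$ (domain $\{x:(ef)(A)x\in\operatorname{ran}e(A)\}$) whenever $e,ef$ are such Laplace transforms and $e(A)$ is injective; every Bernstein function is covered. Cesàro means: $\mathcal C_t(A)x:=\frac1t\int_0^tT(s)x\,\mathrm ds$. The semigroup is mean ergodic if $X=\ker(A)\oplus\overline{\operatorname{ran}}(A)$. *)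

theory Defs
  imports "HOL-Analysis.Analysis" "HOL-Library.Landau_Symbols"
begin

text \<open>Isabelle/HOL has no class of complex vector spaces. A complex Banach space is
a real Banach space together with a bounded real-linear J (multiplication by i) with
J (J x) = -x and norm (cos th x + sin th J x) = norm x, i.e. norm (c x) = |c| norm x
for all complex scalars c.\<close>

definition complex_structure :: "('a::banach \<Rightarrow>\<^sub>L 'a) \<Rightarrow> bool" where
  "complex_structure J \<longleftrightarrow>
     (\<forall>x. J (J x) = - x) \<and>
     (\<forall>th x. norm (cos th *\<^sub>R x + sin th *\<^sub>R J x) = norm x)"

definition c0_semigroup :: "(real \<Rightarrow> ('a::banach \<Rightarrow>\<^sub>L 'a)) \<Rightarrow> bool" where
  "c0_semigroup T \<longleftrightarrow>
     T 0 = id_blinfun \<and>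
     (\<forall>s t. 0 \<le> s \<longrightarrow> 0 \<le> t \<longrightarrow> T (s + t) = T s o\<^sub>L T t) \<and>
     (\<forall>x. continuous_on {0..} (\<lambda>s. T s x))"

definition bounded_semigroup :: "(real \<Rightarrow> ('a::banach \<Rightarrow>\<^sub>L 'a)) \<Rightarrow> bool" where
  "bounded_semigroup T \<longleftrightarrow> (\<exists>M. \<forall>s\<ge>0. norm (T s) \<le> M)"

text \<open>Complex linearity of the semigroup operators.\<close>
definition commutes_with :: "(real \<Rightarrow> ('a::banach \<Rightarrow>\<^sub>L 'a)) \<Rightarrow> ('a \<Rightarrow>\<^sub>L 'a) \<Rightarrow> bool" where
  "commutes_with T J \<longleftrightarrow> (\<forall>s\<ge>0. T s o\<^sub>L J = J o\<^sub>L T s)"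

definition negGen :: "(real \<Rightarrow> ('a::banach \<Rightarrow>\<^sub>L 'a)) \<Rightarrow> ('a \<times> 'a) set" where
  "negGen T = {(x, y). ((\<lambda>h. (1 / h) *\<^sub>R (T h x - x)) \<longlongrightarrow> - y) (at_right 0)}"

definition op_ker :: "('a \<times> 'a::real_vector) set \<Rightarrow> 'a set" where
  "op_ker G = {x. (x, 0) \<in> G}"

definition op_ran :: "('a \<times> 'b) set \<Rightarrow> 'b set" where
  "op_ran G = snd ` G"

definition op_dom :: "('a \<times> 'b) set \<Rightarrow> 'a set" where
  "op_dom G = fst ` G"

definition mean_ergodic :: "(real \<Rightarrow> ('a::banach \<Rightarrow>\<^sub>L 'a)) \<Rightarrow> bool" where
  "mean_ergodic T \<longleftrightarrow>
     op_ker (negGen T) \<inter> closure (op_ran (negGen T)) = {0} \<and>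
     (\<forall>x. \<exists>u v. u \<in> op_ker (negGen T) \<and> v \<in> closure (op_ran (negGen T)) \<and> x = u + v)"

definition cesaro :: "(real \<Rightarrow> ('a::banach \<Rightarrow>\<^sub>L 'a)) \<Rightarrow> real \<Rightarrow> 'a \<Rightarrow> 'a" where
  "cesaro T t x = (1 / t) *\<^sub>R integral {0..t} (\<lambda>s. T s x)"

text \<open>A bounded complex measure on [0,\<infinity>) is represented by four finite positive
measures (n1,n2,n3,n4), standing for n1 - n2 + i (n3 - n4) (Jordan decomposition).\<close>
type_synonym cmeasure = "real measure \<times> real measure \<times> real measure \<times> real measure"

definition fin_meas0 :: "real measure \<Rightarrow> bool" where
  "fin_meas0 m \<longleftrightarrow> finite_measure m \<and> sets m = sets (restrict_space borel {0::real..})"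

definition cmeas :: "cmeasure \<Rightarrow> bool" where
  "cmeas \<nu> = (case \<nu> of (n1, n2, n3, n4) \<Rightarrow>
      fin_meas0 n1 \<and> fin_meas0 n2 \<and> fin_meas0 n3 \<and> fin_meas0 n4)"

definition laplace :: "cmeasure \<Rightarrow> complex \<Rightarrow> complex" where
  "laplace \<nu> z = (case \<nu> of (n1, n2, n3, n4) \<Rightarrow>
      (\<integral>s. exp (- (of_real s * z)) \<partial>n1) - (\<integral>s. exp (- (of_real s * z)) \<partial>n2)
      + \<i> * ((\<integral>s. exp (- (of_real s * z)) \<partial>n3) - (\<integral>s. exp (- (of_real s * z)) \<partial>n4)))"

text \<open>Vector-valued integral \<integral> f d m, characterised (uniquely, by Hahn--Banach) by
testing against all continuous (real-)linear functionals.\<close>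
definition vint :: "real measure \<Rightarrow> (real \<Rightarrow> 'a::real_normed_vector) \<Rightarrow> 'a \<Rightarrow> bool" where
  "vint m f y \<longleftrightarrow>
     (\<forall>\<phi> :: 'a \<Rightarrow> real. bounded_linear \<phi> \<longrightarrow>
        integrable m (\<lambda>s. \<phi> (f s)) \<and> \<phi> y = (\<integral>s. \<phi> (f s) \<partial>m))"

definition hp_op :: "(real \<Rightarrow> ('a::banach \<Rightarrow>\<^sub>L 'a)) \<Rightarrow> ('a \<Rightarrow>\<^sub>L 'a) \<Rightarrow> cmeasure \<Rightarrow> 'a \<Rightarrow> 'a \<Rightarrow> bool" where
  "hp_op T J \<nu> x y = (case \<nu> of (n1, n2, n3, n4) \<Rightarrow>
     (\<exists>y1 y2 y3 y4. vint n1 (\<lambda>s. T s x) y1 \<and> vint n2 (\<lambda>s. T s x) y2 \<and>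
        vint n3 (\<lambda>s. T s x) y3 \<and> vint n4 (\<lambda>s. T s x) y4 \<and>
        y = y1 - y2 + J (y3 - y4)))"

definition hp_injective :: "(real \<Rightarrow> ('a::banach \<Rightarrow>\<^sub>L 'a)) \<Rightarrow> ('a \<Rightarrow>\<^sub>L 'a) \<Rightarrow> cmeasure \<Rightarrow> bool" where
  "hp_injective T J e \<longleftrightarrow> (\<forall>x x' w. hp_op T J e x w \<longrightarrow> hp_op T J e x' w \<longrightarrow> x = x')"

text \<open>Graph of f(A) := e(A)^{-1} (ef)(A) in the extended Hille--Phillips calculus.\<close>
definition hp_func :: "(real \<Rightarrow> ('a::banach \<Rightarrow>\<^sub>L 'a)) \<Rightarrow> ('a \<Rightarrow>\<^sub>L 'a) \<Rightarrow> (complex \<Rightarrow> complex) \<Rightarrow> ('a \<times> 'a) set" where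
  "hp_func T J f = {(x, y). \<exists>e \<nu>. cmeas e \<and> cmeas \<nu> \<and>
       (\<forall>z. 0 < Re z \<longrightarrow> laplace \<nu> z = laplace e z * f z) \<and>
       hp_injective T J e \<and>
       (\<exists>w. hp_op T J \<nu> x w \<and> hp_op T J e y w)}"

definition levy_measure :: "real measure \<Rightarrow> bool" where
  "levy_measure \<mu> \<longleftrightarrow> sets \<mu> = sets (restrict_space borel {0::real<..}) \<and>
      integrable \<mu> (\<lambda>s. s / (1 + s))"

definition bernstein :: "real \<Rightarrow> real \<Rightarrow> real measure \<Rightarrow> complex \<Rightarrow> complex" where
  "bernstein a b \<mu> z = of_real a + of_real b * z + (\<integral>s. (1 - exp (- (of_real s * z))) \<partial>\<mu>)"

definition rate :: "real \<Rightarrow> real \<Rightarrow> real measure \<Rightarrow> real \<Rightarrow> real" where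
  "rate a b \<mu> t = a / 2 + b / t + (\<integral>s. min (s / t) 1 \<partial>\<mu>)"

end

theory Submission
  imports Defs
begin

text \<open>Put \<open>c\<^sub>t(z) = (1 - exp (- t z)) / (t z)\<close>, the Laplace transform of the uniform distribution on
  \<open>[0, t]\<close>. The product \<open>c\<^sub>t g\<close> is the transform of a signed measure \<open>\<lambda>\<^sub>t\<close> of total variation at most
  \<open>2 r(t)\<close>, and uniqueness of Laplace transforms together with the injectivity of the regulariser
  \<open>e(A)\<close> gives \<open>C\<^sub>t(A) y = \<lambda>\<^sub>t(A) x\<close> for \<open>y = g(A) x\<close>; this is (a).
  For (b), \<open>\<lambda>\<^sub>t(A)\<close> vanishes on \<open>ker A\<close> when \<open>a = 0\<close>, and
  \<open>\<lambda>\<^sub>t(A) (I - T h) = (h / t) (I - T t) \<lambda>\<^sub>h(A) = O(1 / t)\<close>, while the ranges of the \<open>I - T h\<close>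
  approximate the closure of \<open>ran A\<close>.
  For (c), boundedness of \<open>t r(t)\<close> forces \<open>a = 0\<close> and a finite first moment of \<open>\<mu>\<close>, so \<open>g(z) / z\<close> is
  itself the transform of a finite measure \<open>\<kappa>\<close>, and \<open>y = A \<kappa>(A) x\<close>.\<close>

section \<open>Norming functionals\<close>

text \<open>The graph of g(A) comes with an arbitrary regulariser e and an arbitrary \<nu> whose
  transform is e g, so nothing may be assumed about their shape; the only handle is the scalar
  identity between the transforms. The development is therefore arranged so that operator identities
  reduce to identities between products of transforms at real k > 0 (\<open>hp_prod_eq\<close>).
  This needs three facts about the functionals: they can be convolved, they are determined by their
  transforms, and they can be applied to orbits. Real k suffices although e and \<nu> are complex: g
  and the transform of the Cesaro mean are real there, so the identity splits into a real and an
  imaginary part, and J enters only when the two are recombined. Operators are tested against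
  real-linear functionals throughout; a functional norming the result turns total variation into an
  operator bound.\<close>

lemma norming_functional:
  fixes x :: "'a::real_normed_vector"
  obtains \<phi> :: "'a \<Rightarrow> real"
  where "bounded_linear \<phi>" "\<And>z. \<bar>\<phi> z\<bar> \<le> norm z" "\<phi> x = norm x"
proof -
  \<comment> \<open>Hahn-Banach by Zorn on graphs ordered by inclusion. The one-sided bound is
    enough: at z = 0 it makes a graph single-valued, and applied at z and -z it yields the two-sided
    bound at the end.\<close>
  define \<A> where "\<A> = {G :: ('a \<times> real) set. subspace G \<and> (\<forall>z r. (z, r) \<in> G \<longrightarrow> r \<le> norm z) \<and> (x, norm x) \<in> G}"
  have "\<exists>G\<in>\<A>. \<forall>X\<in>\<A>. G \<subseteq> X \<longrightarrow> X = G"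
  proof (rule subset_Zorn_nonempty)
    have "subspace (span {(x, norm x)})" by (rule subspace_span)
    then have "span {(x, norm x)} \<in> \<A>"
      by (auto simp: \<A>_def span_singleton intro!: mult_right_mono image_eqI[where x=1])
    then show "\<A> \<noteq> {}" by blast
  next
    fix C assume C: "C \<noteq> {}" "subset.chain \<A> C"
    then have sub: "\<And>G. G \<in> C \<Longrightarrow> G \<in> \<A>" and lin: "\<And>G H. G \<in> C \<Longrightarrow> H \<in> C \<Longrightarrow> G \<subseteq> H \<or> H \<subseteq> G"
      by (auto simp: subset.chain_def)
    have "subspace (\<Union>C)"
    proof (rule subspaceI)
      show "0 \<in> \<Union>C" using C(1) sub by (auto simp: \<A>_def intro: subspace_0)
    next
      fix p q assume "p \<in> \<Union>C" "q \<in> \<Union>C"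
      then obtain G where "G \<in> C" "p \<in> G" "q \<in> G" using lin by blast
      then show "p + q \<in> \<Union>C" using sub[of G] by (auto simp: \<A>_def intro: subspace_add)
    next
      fix c p assume "p \<in> \<Union>C"
      then obtain G where G: "G \<in> C" "p \<in> G" by blast
      then have "c *\<^sub>R p \<in> G" using sub[of G] by (auto simp: \<A>_def intro: subspace_scale)
      then show "c *\<^sub>R p \<in> \<Union>C" using G by blast
    qed
    then show "\<Union>C \<in> \<A>" using C(1) sub unfolding \<A>_def by blast
  qed
  then obtain G where GA: "G \<in> \<A>" and max: "\<And>X. X \<in> \<A> \<Longrightarrow> G \<subseteq> X \<Longrightarrow> X = G" by blast
  have G: "subspace G" and dom: "\<And>z r. (z, r) \<in> G \<Longrightarrow> r \<le> norm z" and xG: "(x, norm x) \<in> G"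
    using GA by (auto simp: \<A>_def)
  have total: "\<exists>r. (z, r) \<in> G" for z
  proof (rule ccontr)
    assume z: "\<nexists>r. (z, r) \<in> G"
    have key: "r - norm (u - z) \<le> norm (u' + z) - r'" if "(u, r) \<in> G" "(u', r') \<in> G" for u u' r r'
    proof -
      have "(u + u', r + r') \<in> G" using subspace_add[OF G that] by simp
      then have "r + r' \<le> norm (u + u')" by (rule dom)
      also have "\<dots> \<le> norm (u - z) + norm (u' + z)"
        using norm_triangle_ineq[of "u - z" "u' + z"] by simp
      finally show ?thesis by simp
    qed
    \<comment> \<open>An admissible value at the missing z must lie above all r - norm (u - z) and
      below all norm (u' + z) - r'. By \<open>key\<close> these bounds do not cross, so the supremum
      of the lower ones works.\<close>
    define S where "S = {r - norm (u - z) | u r. (u, r) \<in> G}"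
    have S: "S \<noteq> {}" "bdd_above S"
      using xG key[OF _ xG] by (auto simp: S_def bdd_above_def)
    define c where "c = Sup S"
    have c1: "r - norm (u - z) \<le> c" if "(u, r) \<in> G" for u r
      unfolding c_def by (rule cSup_upper) (use that S in \<open>auto simp: S_def\<close>)
    have c2: "c \<le> norm (u + z) - r" if "(u, r) \<in> G" for u r
      unfolding c_def by (rule cSup_least) (use that S key in \<open>auto simp: S_def\<close>)
    define H where "H = span (insert (z, c) G)"
    have "r \<le> norm u" if ur: "(u, r) \<in> H" for u r
    proof -
      obtain k where "(u, r) - k *\<^sub>R (z, c) \<in> span G"
        using ur unfolding H_def span_insert by blast
      then have k: "(u - k *\<^sub>R z, r - k * c) \<in> G" using G by (simp add: span_eq_iff[THEN iffD2])
      \<comment> \<open>Dividing by the absolute value of k reduces to the coefficients 1 and -1,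
        where \<open>c2\<close> and \<open>c1\<close> are exactly the required bounds.\<close>
      consider "k = 0" | "k > 0" | "k < 0" by linarith
      then show ?thesis
      proof cases
        case 1 then show ?thesis using dom k by simp
      next
        case 2
        have "((1/k) *\<^sub>R (u - k *\<^sub>R z), (1/k) * (r - k * c)) \<in> G"
          using subspace_scale[OF G k, of "1/k"] by simp
        from c2[OF this] have "c \<le> norm ((1/k) *\<^sub>R u) - (r / k - c)"
          using 2 by (simp add: algebra_simps diff_divide_distrib)
        then have "r / k \<le> norm u / k" using 2 by simp
        then show ?thesis using 2 by (simp add: divide_le_cancel)
      next
        case 3
        have "((-1/k) *\<^sub>R (u - k *\<^sub>R z), (-1/k) * (r - k * c)) \<in> G"
          using subspace_scale[OF G k, of "-1/k"] by simp
        from c1[OF this] have "(- r / k + c) - norm ((-1/k) *\<^sub>R u) \<le> c"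
          using 3 by (simp add: algebra_simps diff_divide_distrib)
        then have "r / (-k) \<le> norm u / (-k)" using 3 by simp
        then show ?thesis using 3 by (simp add: divide_le_cancel)
      qed
    qed
    moreover have "G \<subseteq> H" unfolding H_def using span_superset by blast
    ultimately have "H \<in> \<A>" using xG by (auto simp: \<A>_def H_def)
    with \<open>G \<subseteq> H\<close> max have "H = G" by blast
    moreover have "(z, c) \<in> H" unfolding H_def by (simp add: span_base)
    ultimately show False using z by blast
  qed
  have uniq: "r = r'" if "(z, r) \<in> G" "(z, r') \<in> G" for z r r'
    using dom[of 0 "r - r'"] dom[of 0 "r' - r"] subspace_diff[OF G that] subspace_diff[OF G that(2,1)] by simp
  define \<phi> where "\<phi> z = (SOME r. (z, r) \<in> G)" for z
  have \<phi>: "(z, \<phi> z) \<in> G" for z unfolding \<phi>_def by (rule someI_ex[OF total])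
  have add: "\<phi> (u + v) = \<phi> u + \<phi> v" for u v
    using uniq[OF \<phi>] subspace_add[OF G \<phi> \<phi>] by fastforce
  have scale: "\<phi> (c *\<^sub>R u) = c *\<^sub>R \<phi> u" for c u
    using uniq[OF \<phi>] subspace_scale[OF G \<phi>] by fastforce
  have "\<bar>\<phi> z\<bar> \<le> norm z" for z
    using dom[OF \<phi>[of z]] dom[OF \<phi>[of "-z"]] scale[of "-1" z] by simp
  moreover from this have "bounded_linear \<phi>"
    by (intro bounded_linear_intro[where K=1]) (auto simp: add scale)
  moreover have "\<phi> x = norm x" by (rule uniq[OF \<phi> xG])
  ultimately show ?thesis using that by blast
qed

lemma norm_le_functional:
  fixes x :: "'a::real_normed_vector"
  assumes "\<And>\<phi> :: 'a \<Rightarrow> real. bounded_linear \<phi> \<Longrightarrow> (\<And>z. \<bar>\<phi> z\<bar> \<le> norm z) \<Longrightarrow> \<phi> x \<le> B"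
  shows "norm x \<le> B"
  by (metis assms norming_functional)

lemma eq_functional:
  fixes x y :: "'a::real_normed_vector"
  assumes "\<And>\<phi> :: 'a \<Rightarrow> real. bounded_linear \<phi> \<Longrightarrow> \<phi> x = \<phi> y"
  shows "x = y"
proof -
  obtain \<phi> :: "'a \<Rightarrow> real" where "bounded_linear \<phi>" "\<phi> (x - y) = norm (x - y)"
    using norming_functional by blast
  then show ?thesis using assms[of \<phi>] by (simp add: linear_diff bounded_linear.linear)
qed

section \<open>Continuous functionals on bounded continuous functions\<close>

definition bcont :: "(real \<Rightarrow> real) \<Rightarrow> bool" where
  "bcont P \<longleftrightarrow> continuous_on {0..} P \<and> (\<exists>B. \<forall>s\<ge>0. \<bar>P s\<bar> \<le> B)"

text \<open>By Daniell's theorem these are the signed measures on \<open>[0,\<infinity>)\<close> of total variation at most \<open>C\<close>;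
  working with functionals makes the convolution a mere composition, so that neither product
  measures nor Fubini's theorem are needed.\<close>

definition sfun :: "real \<Rightarrow> ((real \<Rightarrow> real) \<Rightarrow> real) \<Rightarrow> bool" where
  "sfun C \<Lambda> \<longleftrightarrow> 0 \<le> C \<and>
     (\<forall>P Q. bcont P \<longrightarrow> bcont Q \<longrightarrow> \<Lambda> (\<lambda>s. P s + Q s) = \<Lambda> P + \<Lambda> Q) \<and>
     (\<forall>c P. bcont P \<longrightarrow> \<Lambda> (\<lambda>s. c * P s) = c * \<Lambda> P) \<and>
     (\<forall>P B. bcont P \<longrightarrow> (\<forall>s\<ge>0. \<bar>P s\<bar> \<le> B) \<longrightarrow> \<bar>\<Lambda> P\<bar> \<le> C * B) \<and>
     (\<forall>Q P B. (\<forall>n::nat. bcont (Q n)) \<longrightarrow> bcont P \<longrightarrow> (\<forall>n. \<forall>s\<ge>0. \<bar>Q n s\<bar> \<le> B) \<longrightarrow>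
        (\<forall>s\<ge>0. (\<lambda>n. Q n s) \<longlonglongrightarrow> P s) \<longrightarrow> (\<lambda>n. \<Lambda> (Q n)) \<longlonglongrightarrow> \<Lambda> P)"

lemma sfunI:
  assumes "0 \<le> C"
    and "\<And>P Q. bcont P \<Longrightarrow> bcont Q \<Longrightarrow> \<Lambda> (\<lambda>s. P s + Q s) = \<Lambda> P + \<Lambda> Q"
    and "\<And>c P. bcont P \<Longrightarrow> \<Lambda> (\<lambda>s. c * P s) = c * \<Lambda> P"
    and "\<And>P B. bcont P \<Longrightarrow> (\<And>s. 0 \<le> s \<Longrightarrow> \<bar>P s\<bar> \<le> B) \<Longrightarrow> \<bar>\<Lambda> P\<bar> \<le> C * B"
    and "\<And>Q P B. (\<And>n::nat. bcont (Q n)) \<Longrightarrow> bcont P \<Longrightarrow> (\<And>n s. 0 \<le> s \<Longrightarrow> \<bar>Q n s\<bar> \<le> B) \<Longrightarrow>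
        (\<And>s. 0 \<le> s \<Longrightarrow> (\<lambda>n. Q n s) \<longlonglongrightarrow> P s) \<Longrightarrow> (\<lambda>n. \<Lambda> (Q n)) \<longlonglongrightarrow> \<Lambda> P"
  shows "sfun C \<Lambda>"
  unfolding sfun_def
proof (intro conjI allI impI)
  fix Q :: "nat \<Rightarrow> real \<Rightarrow> real" and P B
  assume "\<forall>n. bcont (Q n)" "bcont P" "\<forall>n. \<forall>s\<ge>0. \<bar>Q n s\<bar> \<le> B" "\<forall>s\<ge>0. (\<lambda>n. Q n s) \<longlonglongrightarrow> P s"
  then show "(\<lambda>n. \<Lambda> (Q n)) \<longlonglongrightarrow> \<Lambda> P" by (intro assms(5)[where B=B]) auto
next
  fix P B assume "bcont P" "\<forall>s\<ge>0. \<bar>P s\<bar> \<le> B"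
  then show "\<bar>\<Lambda> P\<bar> \<le> C * B" by (intro assms(4)) auto
qed (simp_all add: assms(1-3))

lemma
  assumes "sfun C \<Lambda>"
  shows sfun_nonneg: "0 \<le> C"
    and sfun_add: "bcont P \<Longrightarrow> bcont Q \<Longrightarrow> \<Lambda> (\<lambda>s. P s + Q s) = \<Lambda> P + \<Lambda> Q"
    and sfun_cmult: "bcont P \<Longrightarrow> \<Lambda> (\<lambda>s. c * P s) = c * \<Lambda> P"
    and sfun_bound: "bcont P \<Longrightarrow> (\<And>s. 0 \<le> s \<Longrightarrow> \<bar>P s\<bar> \<le> B) \<Longrightarrow> \<bar>\<Lambda> P\<bar> \<le> C * B"
    and sfun_lim: "(\<And>n::nat. bcont (R n)) \<Longrightarrow> bcont P \<Longrightarrow> (\<And>n s. 0 \<le> s \<Longrightarrow> \<bar>R n s\<bar> \<le> B) \<Longrightarrow>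
        (\<And>s. 0 \<le> s \<Longrightarrow> (\<lambda>n. R n s) \<longlonglongrightarrow> P s) \<Longrightarrow> (\<lambda>n. \<Lambda> (R n)) \<longlonglongrightarrow> \<Lambda> P"
  using assms unfolding sfun_def by blast+

lemma bcontI: "continuous_on {0..} P \<Longrightarrow> (\<And>s. 0 \<le> s \<Longrightarrow> \<bar>P s\<bar> \<le> B) \<Longrightarrow> bcont P"
  unfolding bcont_def by blast

lemma bcontE:
  assumes "bcont P"
  obtains B where "0 \<le> B" "\<And>s. 0 \<le> s \<Longrightarrow> \<bar>P s\<bar> \<le> B" "continuous_on {0..} P"
  using assms unfolding bcont_def by (meson abs_ge_zero order.refl order.trans)

lemma bcont_const [intro, simp]: "bcont (\<lambda>_. c)"
  by (rule bcontI[where B="\<bar>c\<bar>"]) auto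

lemma bcont_add [intro]: "bcont P \<Longrightarrow> bcont Q \<Longrightarrow> bcont (\<lambda>s. P s + Q s)"
  by (elim bcontE, rule bcontI) (auto intro!: continuous_intros intro: abs_triangle_ineq[THEN order_trans] add_mono)

lemma bcont_mult [intro]:
  assumes "bcont P" "bcont Q" shows "bcont (\<lambda>s. P s * Q s)"
proof -
  from assms obtain B B' where "continuous_on {0..} P" "continuous_on {0..} Q" "0 \<le> B" "0 \<le> B'"
    "\<And>s. 0 \<le> s \<Longrightarrow> \<bar>P s\<bar> \<le> B" "\<And>s. 0 \<le> s \<Longrightarrow> \<bar>Q s\<bar> \<le> B'" by (metis bcontE)
  then show ?thesis
    by (intro bcontI[where B="B * B'"]) (auto intro!: continuous_intros mult_mono simp: abs_mult)
qed

lemma bcont_cmult [intro]: "bcont P \<Longrightarrow> bcont (\<lambda>s. c * P s)"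
  by (rule bcont_mult) auto

lemma bcont_diff [intro]: "bcont P \<Longrightarrow> bcont Q \<Longrightarrow> bcont (\<lambda>s. P s - Q s)"
  using bcont_add[OF _ bcont_cmult[of Q "-1"], of P] by simp

lemma bcont_sum [intro]: "(\<And>i. i \<in> I \<Longrightarrow> bcont (P i)) \<Longrightarrow> bcont (\<lambda>s. \<Sum>i\<in>I. P i s)"
  by (induction I rule: infinite_finite_induct) auto

lemma bcont_exp [intro]: "0 \<le> k \<Longrightarrow> bcont (\<lambda>s. exp (- (k * s)))"
  by (rule bcontI[where B=1]) (auto intro!: continuous_intros)

lemma bcont_shift:
  assumes "bcont P" "0 \<le> t" shows "bcont (\<lambda>s. P (s + t))"
proof -
  from assms(1) obtain B where "\<And>s. 0 \<le> s \<Longrightarrow> \<bar>P s\<bar> \<le> B" "continuous_on {0..} P" by (rule bcontE) blast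
  then show ?thesis
    using assms(2) by (intro bcontI[where B=B]) (auto intro!: continuous_on_compose2[of "{0..}" P] continuous_intros)
qed

lemma bcont_shift': "bcont P \<Longrightarrow> 0 \<le> t \<Longrightarrow> bcont (\<lambda>s. P (t + s))"
  using bcont_shift[of P t] by (simp add: add.commute)

lemma bcont_power: "bcont P \<Longrightarrow> bcont (\<lambda>s. P s ^ n)"
  by (induction n) auto

context
  fixes C \<Lambda> assumes \<Lambda>: "sfun C \<Lambda>"
begin

lemma sfun_diff: "bcont P \<Longrightarrow> bcont Q \<Longrightarrow> \<Lambda> (\<lambda>s. P s - Q s) = \<Lambda> P - \<Lambda> Q"
  using sfun_add[OF \<Lambda>, of P "\<lambda>s. -1 * Q s"] sfun_cmult[OF \<Lambda>, of Q "-1"] bcont_cmult[of Q "-1"] by simp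

lemma sfun_zero: "\<Lambda> (\<lambda>_. 0) = 0"
  using sfun_cmult[OF \<Lambda>, of "\<lambda>_. 0" 0] by simp

text \<open>The bound clause with B = 0, applied to P - Q, makes functionals blind to negative
  arguments, which \<open>bcont\<close> leaves unconstrained.\<close>

lemma sfun_cong:
  assumes "bcont P" "bcont Q" "\<And>s. 0 \<le> s \<Longrightarrow> P s = Q s" shows "\<Lambda> P = \<Lambda> Q"
  using sfun_bound[OF \<Lambda> bcont_diff[OF assms(1,2)], of 0] sfun_diff[OF assms(1,2)] assms(3) by simp

lemma sfun_sum: "(\<And>i. i \<in> I \<Longrightarrow> bcont (P i)) \<Longrightarrow> \<Lambda> (\<lambda>s. \<Sum>i\<in>I. P i s) = (\<Sum>i\<in>I. \<Lambda> (P i))"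
  by (induction I rule: infinite_finite_induct) (auto simp: sfun_zero sfun_add[OF \<Lambda>] bcont_sum)

end

lemma sfun_plus:
  assumes "sfun C \<Lambda>" "sfun D \<Gamma>" shows "sfun (C + D) (\<lambda>P. \<Lambda> P + \<Gamma> P)"
proof (rule sfunI)
  show "0 \<le> C + D" using sfun_nonneg[OF assms(1)] sfun_nonneg[OF assms(2)] by simp
next
  fix P B assume *: "bcont P" "\<And>s. 0 \<le> s \<Longrightarrow> \<bar>P s\<bar> \<le> B"
  show "\<bar>\<Lambda> P + \<Gamma> P\<bar> \<le> (C + D) * B"
    using sfun_bound[OF assms(1) *] sfun_bound[OF assms(2) *] by (simp add: distrib_right)
next
  fix Q :: "nat \<Rightarrow> real \<Rightarrow> real" and P B
  assume *: "\<And>n. bcont (Q n)" "bcont P" "\<And>n s. 0 \<le> s \<Longrightarrow> \<bar>Q n s\<bar> \<le> B"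
    "\<And>s. 0 \<le> s \<Longrightarrow> (\<lambda>n. Q n s) \<longlonglongrightarrow> P s"
  show "(\<lambda>n. \<Lambda> (Q n) + \<Gamma> (Q n)) \<longlonglongrightarrow> \<Lambda> P + \<Gamma> P"
    using sfun_lim[OF assms(1) *] sfun_lim[OF assms(2) *] by (rule tendsto_add)
qed (simp_all add: sfun_add[OF assms(1)] sfun_cmult[OF assms(1)] sfun_add[OF assms(2)]
    sfun_cmult[OF assms(2)] algebra_simps)

lemma sfun_scale:
  assumes "sfun C \<Lambda>" shows "sfun (\<bar>c\<bar> * C) (\<lambda>P. c * \<Lambda> P)"
proof (rule sfunI)
  show "0 \<le> \<bar>c\<bar> * C" using sfun_nonneg[OF assms] by simp
next
  fix P B assume *: "bcont P" "\<And>s. 0 \<le> s \<Longrightarrow> \<bar>P s\<bar> \<le> B"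
  show "\<bar>c * \<Lambda> P\<bar> \<le> \<bar>c\<bar> * C * B"
    using sfun_bound[OF assms *] by (simp add: abs_mult mult.assoc mult_left_mono)
next
  fix Q :: "nat \<Rightarrow> real \<Rightarrow> real" and P B
  assume *: "\<And>n. bcont (Q n)" "bcont P" "\<And>n s. 0 \<le> s \<Longrightarrow> \<bar>Q n s\<bar> \<le> B"
    "\<And>s. 0 \<le> s \<Longrightarrow> (\<lambda>n. Q n s) \<longlonglongrightarrow> P s"
  show "(\<lambda>n. c * \<Lambda> (Q n)) \<longlonglongrightarrow> c * \<Lambda> P"
    using sfun_lim[OF assms *] by (rule tendsto_mult_left)
qed (simp_all add: sfun_add[OF assms(1)] sfun_cmult[OF assms(1)] algebra_simps)

lemma sfun_minus:
  assumes "sfun C \<Lambda>" "sfun D \<Gamma>" shows "sfun (C + D) (\<lambda>P. \<Lambda> P - \<Gamma> P)"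
  using sfun_plus[OF assms(1) sfun_scale[OF assms(2), of "-1"]] by simp

section \<open>Point masses and convolution\<close>

lemma sfun_eval: "0 \<le> t \<Longrightarrow> sfun 1 (\<lambda>P. P t)"
  by (rule sfunI) auto

text \<open>Continuity in s is checked along sequences: the limit clause of \<open>sfun\<close>
  turns the pointwise convergence of the translates of P, all bounded by B, into convergence of the
  values of \<Gamma>.\<close>

lemma bcont_conv:
  assumes "sfun D \<Gamma>" "bcont P" shows "bcont (\<lambda>s. \<Gamma> (\<lambda>u. P (s + u)))"
proof -
  from assms(2) obtain B where B: "\<And>s. 0 \<le> s \<Longrightarrow> \<bar>P s\<bar> \<le> B" and c: "continuous_on {0..} P"
    by (rule bcontE) blast
  show ?thesis
  proof (rule bcontI)
    show "\<bar>\<Gamma> (\<lambda>u. P (s + u))\<bar> \<le> D * B" if "0 \<le> s" for s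
      by (rule sfun_bound[OF assms(1) bcont_shift'[OF assms(2) that]]) (simp add: B that)
    show "continuous_on {0..} (\<lambda>s. \<Gamma> (\<lambda>u. P (s + u)))"
      unfolding continuous_on_sequentially comp_def
    proof (intro allI ballI impI, elim conjE)
      fix x and s :: real assume s: "s \<in> {0..}" and x: "\<forall>n. x n \<in> {0..}" "x \<longlonglongrightarrow> s"
      then have nn: "0 \<le> s" "0 \<le> x n" for n by auto
      show "(\<lambda>n. \<Gamma> (\<lambda>u. P (x n + u))) \<longlonglongrightarrow> \<Gamma> (\<lambda>u. P (s + u))"
      proof (rule sfun_lim[OF assms(1) bcont_shift'[OF assms(2) nn(2)] bcont_shift'[OF assms(2) nn(1)]])
        fix u :: real assume u: "0 \<le> u"
        show "(\<lambda>n. P (x n + u)) \<longlonglongrightarrow> P (s + u)"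
          by (rule continuous_on_tendsto_compose[OF c]) (use x nn u in \<open>auto intro!: tendsto_intros\<close>)
        show "\<bar>P (x n + u)\<bar> \<le> B" for n using B nn(2)[of n] u by simp
      qed
    qed
  qed
qed

text \<open>Total variation is submultiplicative under convolution. The inner functional may be
  rewritten only for s \<ge> 0, hence the detours through \<open>sfun_cong\<close>.\<close>

lemma sfun_conv:
  assumes "sfun C \<Lambda>" "sfun D \<Gamma>"
  shows "sfun (C * D) (\<lambda>P. \<Lambda> (\<lambda>s. \<Gamma> (\<lambda>u. P (s + u))))"
proof (rule sfunI)
  show "0 \<le> C * D" using assms sfun_nonneg by (intro mult_nonneg_nonneg)
next
  fix P Q assume P: "bcont P" and Q: "bcont Q"
  have "\<Lambda> (\<lambda>s. \<Gamma> (\<lambda>u. P (s + u) + Q (s + u))) = \<Lambda> (\<lambda>s. \<Gamma> (\<lambda>u. P (s + u)) + \<Gamma> (\<lambda>u. Q (s + u)))"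
    by (rule sfun_cong[OF assms(1) bcont_conv[OF assms(2) bcont_add[OF P Q]]
          bcont_add[OF bcont_conv[OF assms(2) P] bcont_conv[OF assms(2) Q]]])
       (rule sfun_add[OF assms(2) bcont_shift'[OF P] bcont_shift'[OF Q]])
  then show "\<Lambda> (\<lambda>s. \<Gamma> (\<lambda>u. P (s + u) + Q (s + u))) = \<Lambda> (\<lambda>s. \<Gamma> (\<lambda>u. P (s + u))) + \<Lambda> (\<lambda>s. \<Gamma> (\<lambda>u. Q (s + u)))"
    by (simp only: sfun_add[OF assms(1) bcont_conv[OF assms(2) P] bcont_conv[OF assms(2) Q]])
next
  fix c P assume P: "bcont P"
  have "\<Lambda> (\<lambda>s. \<Gamma> (\<lambda>u. c * P (s + u))) = \<Lambda> (\<lambda>s. c * \<Gamma> (\<lambda>u. P (s + u)))"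
    by (rule sfun_cong[OF assms(1) bcont_conv[OF assms(2) bcont_cmult[OF P]]
          bcont_cmult[OF bcont_conv[OF assms(2) P]]])
       (rule sfun_cmult[OF assms(2) bcont_shift'[OF P]])
  then show "\<Lambda> (\<lambda>s. \<Gamma> (\<lambda>u. c * P (s + u))) = c * \<Lambda> (\<lambda>s. \<Gamma> (\<lambda>u. P (s + u)))"
    by (simp only: sfun_cmult[OF assms(1) bcont_conv[OF assms(2) P]])
next
  fix P B assume P: "bcont P" "\<And>s. 0 \<le> s \<Longrightarrow> \<bar>P s\<bar> \<le> B"
  have "\<bar>\<Gamma> (\<lambda>u. P (s + u))\<bar> \<le> D * B" if "0 \<le> s" for s
    by (rule sfun_bound[OF assms(2) bcont_shift'[OF P(1) that]]) (simp add: P that)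
  then show "\<bar>\<Lambda> (\<lambda>s. \<Gamma> (\<lambda>u. P (s + u)))\<bar> \<le> C * D * B"
    unfolding mult.assoc by (rule sfun_bound[OF assms(1) bcont_conv[OF assms(2) P(1)]])
next
  fix Q :: "nat \<Rightarrow> real \<Rightarrow> real" and P B
  assume *: "\<And>n. bcont (Q n)" "bcont P" "\<And>n s. 0 \<le> s \<Longrightarrow> \<bar>Q n s\<bar> \<le> B"
    "\<And>s. 0 \<le> s \<Longrightarrow> (\<lambda>n. Q n s) \<longlonglongrightarrow> P s"
  show "(\<lambda>n. \<Lambda> (\<lambda>s. \<Gamma> (\<lambda>u. Q n (s + u)))) \<longlonglongrightarrow> \<Lambda> (\<lambda>s. \<Gamma> (\<lambda>u. P (s + u)))"
  proof (rule sfun_lim[OF assms(1) bcont_conv[OF assms(2) *(1)] bcont_conv[OF assms(2) *(2)]])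
    show "\<bar>\<Gamma> (\<lambda>u. Q n (s + u))\<bar> \<le> D * B" if "0 \<le> s" for n s
      by (rule sfun_bound[OF assms(2) bcont_shift'[OF *(1) that]]) (simp add: * that)
    show "(\<lambda>n. \<Gamma> (\<lambda>u. Q n (s + u))) \<longlonglongrightarrow> \<Gamma> (\<lambda>u. P (s + u))" if "0 \<le> s" for s
      by (rule sfun_lim[OF assms(2) bcont_shift'[OF *(1) that] bcont_shift'[OF *(2) that], where B=B])
         (simp_all add: * that)
  qed
qed

section \<open>Uniqueness of Laplace transforms\<close>

lemma sfun_bernstein:
  assumes \<Lambda>: "sfun C \<Lambda>" and 0: "\<And>k. 0 < k \<Longrightarrow> \<Lambda> (\<lambda>s. exp (- (real k * s))) = 0"
    and "0 < k"
  shows "\<Lambda> (\<lambda>s. exp (- s) ^ k * (1 - exp (- s)) ^ j) = 0"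
  using \<open>0 < k\<close>
proof (induction j arbitrary: k)
  case 0
  then show ?case using assms(2)[OF 0] by (simp flip: exp_of_nat_mult)
next
  case (Suc j)
  have "bcont (\<lambda>s. exp (- s))" using bcont_exp[of 1] by simp
  then have b: "bcont (\<lambda>s. exp (- s) ^ i * (1 - exp (- s)) ^ j)" for i
    by (intro bcont_mult bcont_power bcont_diff bcont_const)
  \<comment> \<open>Splitting off one factor 1 - exp (- s) leaves the induction hypothesis for k and
    for k + 1, which is why k stays arbitrary.\<close>
  have "\<Lambda> (\<lambda>s. exp (- s) ^ k * (1 - exp (- s)) ^ Suc j)
      = \<Lambda> (\<lambda>s. exp (- s) ^ k * (1 - exp (- s)) ^ j - exp (- s) ^ Suc k * (1 - exp (- s)) ^ j)"
    by (simp add: algebra_simps)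
  also have "\<dots> = 0" using Suc by (simp only: sfun_diff[OF \<Lambda> b b] zero_less_Suc diff_self)
  finally show ?case .
qed

text \<open>The substitution x = exp (- s) maps [0,\<infinity>) to (0,1], and vanishing for large s
  makes the transported function continuous up to x = 0. Its Bernstein polynomials are combinations
  of the functions of \<open>sfun_bernstein\<close>, and uniform approximation passes to \<Lambda>
  by the bound clause.\<close>

lemma sfun_eq_zero_compact_support:
  assumes \<Lambda>: "sfun C \<Lambda>" and 0: "\<And>k. 0 < k \<Longrightarrow> \<Lambda> (\<lambda>s. exp (- (real k * s))) = 0"
    and P: "bcont P" and R: "0 \<le> R" "\<And>s. R \<le> s \<Longrightarrow> P s = 0"
  shows "\<Lambda> P = 0"
proof -
  \<comment> \<open>The maximum with exp (- R) keeps the logarithm defined; where it takes effect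
    the value is P R = 0, so F agrees with the transported P.\<close>
  define F where "F x = P (- ln (max x (exp (- R))))" for x
  have pos: "0 < max x (exp (- R))" for x by (simp add: less_max_iff_disj)
  have le1: "max x (exp (- R)) \<le> 1" if "x \<le> 1" for x using that R(1) by simp
  have "continuous_on {0..1} F"
    unfolding F_def
  proof (rule continuous_on_compose2[of "{0..}" P])
    show "continuous_on {0..1} (\<lambda>x. - ln (max x (exp (- R))))"
      by (intro continuous_intros ballI) (use pos in \<open>metis less_irrefl\<close>)
    show "(\<lambda>x. - ln (max x (exp (- R)))) ` {0..1} \<subseteq> {0..}"
      using pos le1 by (auto simp: ln_le_zero_iff)
  qed (use P in \<open>auto simp: bcont_def\<close>)
  have F0: "F 0 = 0" using R by (simp add: F_def max_def)
  have FP: "F (exp (- s)) = P s" if "0 \<le> s" for s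
    using that R by (auto simp: F_def max_def)
  have e: "bcont (\<lambda>s. exp (- s))" using bcont_exp[of 1] by simp
  have small: "\<bar>\<Lambda> P\<bar> \<le> C * \<epsilon>" if \<epsilon>: "0 < \<epsilon>" for \<epsilon>
  proof -
    obtain n where n: "\<And>x. x \<in> {0..1} \<Longrightarrow> \<bar>F x - (\<Sum>k\<le>n. F (k/n) * Bernstein n k x)\<bar> < \<epsilon>"
      using Bernstein_Weierstrass[OF \<open>continuous_on {0..1} F\<close> \<epsilon>] by blast
    define c where "c k = F (k/n) * real (n choose k)" for k
    define Q where "Q k s = c k * (exp (- s) ^ k * (1 - exp (- s)) ^ (n - k))" for k s
    have b: "bcont (\<lambda>s. exp (- s) ^ k * (1 - exp (- s)) ^ (n - k))" for k
      using e by (intro bcont_mult bcont_power bcont_diff bcont_const)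
    then have bQ: "bcont (Q k)" for k unfolding Q_def by (rule bcont_cmult)
    have Q0: "\<Lambda> (Q k) = 0" for k
    \<comment> \<open>The basis polynomial for k = 0 is the one not covered by
      \<open>sfun_bernstein\<close>, since its expansion involves the transform at 0. Its
      coefficient is F 0 = 0.\<close>
    proof (cases "k = 0")
      case True
      then have "Q k = (\<lambda>_. 0)" by (simp add: fun_eq_iff Q_def c_def F0)
      then show ?thesis using sfun_zero[OF \<Lambda>] by simp
    next
      case False
      then show ?thesis
        unfolding Q_def sfun_cmult[OF \<Lambda> b] using sfun_bernstein[OF \<Lambda> 0] by simp
    qed
    have "\<Lambda> (\<lambda>s. \<Sum>k\<le>n. Q k s) = 0" by (simp add: sfun_sum[OF \<Lambda> bQ] Q0)
    moreover have "\<bar>\<Lambda> (\<lambda>s. P s - (\<Sum>k\<le>n. Q k s))\<bar> \<le> C * \<epsilon>"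
    proof (rule sfun_bound[OF \<Lambda>])
      show "bcont (\<lambda>s. P s - (\<Sum>k\<le>n. Q k s))" by (intro bcont_diff P bcont_sum bQ)
      fix s :: real assume "0 \<le> s"
      then show "\<bar>P s - (\<Sum>k\<le>n. Q k s)\<bar> \<le> \<epsilon>"
        using n[of "exp (- s)"] by (simp add: FP Q_def c_def Bernstein_def mult.assoc)
    qed
    ultimately show ?thesis
      using sfun_diff[OF \<Lambda> P bcont_sum[where I="{..n}" and P=Q, OF bQ]] by simp
  qed
  have "\<bar>\<Lambda> P\<bar> \<le> 0 + \<epsilon>" if "0 < \<epsilon>" for \<epsilon>
  proof -
    have "C * (\<epsilon> / (C + 1)) \<le> \<epsilon>"
      using sfun_nonneg[OF \<Lambda>] that by (simp add: field_simps)
    then show ?thesis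
      using small[of "\<epsilon> / (C + 1)"] sfun_nonneg[OF \<Lambda>] that by simp
  qed
  then have "\<bar>\<Lambda> P\<bar> \<le> 0" by (rule field_le_epsilon)
  then show ?thesis by simp
qed

text \<open>Cutting P off between n and n + 1 reduces to compact support, and the limit clause
  removes the cut-off. Only transforms at positive integers are compared; equality of the total
  masses is a consequence.\<close>

lemma sfun_unique:
  assumes "sfun C \<Lambda>" "sfun D \<Gamma>" and P: "bcont P"
    and eq: "\<And>k. 0 < k \<Longrightarrow> \<Lambda> (\<lambda>s. exp (- (real k * s))) = \<Gamma> (\<lambda>s. exp (- (real k * s)))"
  shows "\<Lambda> P = \<Gamma> P"
proof -
  let ?L = "\<lambda>P. \<Lambda> P - \<Gamma> P"
  have L: "sfun (C + D) ?L" using assms(1,2) by (rule sfun_minus)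
  obtain B where B: "0 \<le> B" "\<And>s. 0 \<le> s \<Longrightarrow> \<bar>P s\<bar> \<le> B" using P by (rule bcontE) blast
  define Q where "Q n s = P s * max 0 (min 1 (real n + 1 - s))" for n s
  have cut: "bcont (\<lambda>s. max 0 (min 1 (real n + 1 - s)))" for n
    by (rule bcontI[where B=1]) (auto intro!: continuous_intros)
  have bQ: "bcont (Q n)" for n unfolding Q_def using P cut by (rule bcont_mult)
  have "(\<lambda>n. ?L (Q n)) \<longlonglongrightarrow> ?L P"
  proof (rule sfun_lim[OF L bQ P])
    show "\<bar>Q n s\<bar> \<le> B" if "0 \<le> s" for n s
      unfolding Q_def abs_mult using mult_mono[OF B(2)[OF that], of "\<bar>max 0 (min 1 (real n + 1 - s))\<bar>" 1] B(1) by simp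
    show "(\<lambda>n. Q n s) \<longlonglongrightarrow> P s" if "0 \<le> s" for s
    proof (rule tendsto_eventually)
      have "\<forall>\<^sub>F n in sequentially. s \<le> real n"
        by (rule eventually_sequentiallyI[of "nat \<lceil>s\<rceil>"]) linarith
      then show "\<forall>\<^sub>F n in sequentially. Q n s = P s"
        by eventually_elim (simp add: Q_def)
    qed
  qed
  moreover have "?L (Q n) = 0" for n
    by (rule sfun_eq_zero_compact_support[OF L _ bQ, of "real n + 1"]) (auto simp: eq Q_def)
  ultimately have "?L P = 0" using LIMSEQ_unique tendsto_const by fastforce
  then show ?thesis by simp
qed

section \<open>Integrating bounded continuous Banach-space-valued functions against a
  functional\<close>

lemma bcont_functional:
  fixes f :: "real \<Rightarrow> 'a::real_normed_vector"
  assumes f: "continuous_on {0..} f" "\<And>s. 0 \<le> s \<Longrightarrow> norm (f s) \<le> B"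
    and "bounded_linear \<phi>"
  shows "bcont (\<lambda>s. \<phi> (f s))"
proof -
  interpret bounded_linear \<phi> by fact
  obtain K where K: "0 \<le> K" "\<And>x. norm (\<phi> x) \<le> norm x * K" using nonneg_bounded by blast
  show ?thesis
  proof (rule bcontI)
    show "continuous_on {0..} (\<lambda>s. \<phi> (f s))" by (rule continuous_on[OF f(1)])
    show "\<bar>\<phi> (f s)\<bar> \<le> B * K" if "0 \<le> s" for s
      using order_trans[OF K(2) mult_right_mono[OF f(2)[OF that] K(1)]] by simp
  qed
qed

text \<open>The piecewise linear interpolation of \<open>f\<close> at the nodes \<open>j / (n + 1)\<close> up to \<open>n + 1\<close>,
  written with telescoping increments.\<close>

definition interpol :: "nat \<Rightarrow> (real \<Rightarrow> 'a::real_vector) \<Rightarrow> real \<Rightarrow> 'a" where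
  "interpol n f s = f 0 + (\<Sum>k<(n+1)^2. max 0 (min 1 (real (n+1) * s - real k)) *\<^sub>R
      (f (real (k+1) / real (n+1)) - f (real k / real (n+1))))"

text \<open>Coefficients with k < j are saturated at 1 and telescope to the value at node j, the one
  with k = j is the fractional part, and the later ones vanish.\<close>

lemma interpol_inside:
  assumes "0 \<le> s" "s < real (n+1)" and j: "j = nat \<lfloor>real (n+1) * s\<rfloor>"
  shows "interpol n f s = f (real j / real (n+1)) + (real (n+1) * s - real j) *\<^sub>R
      (f (real (j+1) / real (n+1)) - f (real j / real (n+1)))"
proof -
  let ?m = "real (n+1)" and ?g = "\<lambda>k. f (real k / real (n+1))"
  have j1: "real j \<le> ?m * s" "?m * s < real j + 1"
    using assms(1) j by (simp_all add: of_nat_nat floor_correct)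
  have "?m * s < ?m * ?m" using assms(2) by (intro mult_strict_left_mono) auto
  then have "real j < real ((n+1)^2)" using j1 unfolding power2_eq_square of_nat_mult by linarith
  then have jN: "j < (n+1)^2" by linarith
  have "(\<Sum>k<(n+1)^2. max 0 (min 1 (?m * s - real k)) *\<^sub>R (?g (Suc k) - ?g k))
      = (\<Sum>k<Suc j. max 0 (min 1 (?m * s - real k)) *\<^sub>R (?g (Suc k) - ?g k))"
    by (rule sum.mono_neutral_right) (use jN j1 in auto)
  also have "\<dots> = (\<Sum>k<j. ?g (Suc k) - ?g k) + (?m * s - real j) *\<^sub>R (?g (Suc j) - ?g j)"
    using j1 by (auto intro!: sum.cong simp: min_def max_def)
  also have "(\<Sum>k<j. ?g (Suc k) - ?g k) = ?g j - ?g 0" by (rule sum_lessThan_telescope)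
  finally show ?thesis by (simp add: interpol_def)
qed

lemma interpol_outside:
  assumes "real (n+1) \<le> s"
  shows "interpol n f s = f (real (n+1))"
proof -
  let ?m = "real (n+1)" and ?g = "\<lambda>k. f (real k / real (n+1))"
  have "?m * ?m \<le> ?m * s" using assms by (intro mult_left_mono) auto
  then have "real ((n+1)^2) \<le> ?m * s" unfolding power2_eq_square of_nat_mult .
  moreover have "real k + 1 \<le> real ((n+1)^2)" if "k < (n+1)^2" for k using that by linarith
  ultimately have "max 0 (min 1 (?m * s - real k)) = 1" if "k < (n+1)^2" for k
    using that by (force simp: min_def max_def)
  then have "(\<Sum>k<(n+1)^2. max 0 (min 1 (?m * s - real k)) *\<^sub>R (?g (Suc k) - ?g k))
      = (\<Sum>k<(n+1)^2. ?g (Suc k) - ?g k)"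
    by (intro sum.cong) auto
  also have "\<dots> = ?g ((n+1)^2) - ?g 0" by (rule sum_lessThan_telescope)
  also have "real ((n+1)^2) / ?m = ?m"
    unfolding power2_eq_square of_nat_mult by (rule nonzero_mult_div_cancel_right) simp
  finally show ?thesis by (simp add: interpol_def)
qed

text \<open>The crude constant 3 comes from one node value plus a difference of two; any bound
  uniform in n serves for domination.\<close>

lemma interpol_bound:
  fixes f :: "real \<Rightarrow> 'a::real_normed_vector"
  assumes B: "\<And>s. 0 \<le> s \<Longrightarrow> norm (f s) \<le> B" and s: "0 \<le> s"
  shows "norm (interpol n f s) \<le> 3 * B"
proof (cases "s < real (n+1)")
  case True
  define j where "j = nat \<lfloor>real (n+1) * s\<rfloor>"
  define \<theta> where "\<theta> = real (n+1) * s - real j"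
  have \<theta>: "0 \<le> \<theta>" "\<theta> \<le> 1" using s unfolding \<theta>_def j_def by (simp_all, linarith+)
  let ?g = "\<lambda>k. f (real k / real (n+1))"
  have g: "norm (?g k) \<le> B" for k by (rule B) simp
  have "norm (\<theta> *\<^sub>R (?g (j+1) - ?g j)) \<le> 1 * (B + B)"
    unfolding norm_scaleR
    by (rule mult_mono) (use \<theta> g norm_triangle_ineq4[of "?g (j+1)" "?g j"] add_mono[OF g[of "j+1"] g[of j]] in auto)
  moreover have "interpol n f s = ?g j + \<theta> *\<^sub>R (?g (j+1) - ?g j)"
    unfolding \<theta>_def by (rule interpol_inside[OF s True j_def])
  ultimately show ?thesis
    using norm_triangle_ineq[of "?g j" "\<theta> *\<^sub>R (?g (j+1) - ?g j)"] g[of j] by simp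
next
  case False
  have "0 \<le> B" using B[OF s] norm_ge_zero order_trans by blast
  then show ?thesis using False interpol_outside[of n s f] B[of "real (n+1)"] by simp
qed

lemma interpol_tendsto:
  fixes f :: "real \<Rightarrow> 'a::real_normed_vector"
  assumes f: "continuous_on {0..} f" and s: "0 \<le> s"
  shows "(\<lambda>n. interpol n f s) \<longlonglongrightarrow> f s"
proof (rule LIMSEQ_I)
  fix \<epsilon> :: real assume "0 < \<epsilon>"
  then obtain d where d: "0 < d" "\<And>u. 0 \<le> u \<Longrightarrow> dist u s < d \<Longrightarrow> dist (f u) (f s) < \<epsilon> / 3"
    using f s unfolding continuous_on_iff by (metis atLeast_iff zero_less_divide_iff zero_less_numeral)
  \<comment> \<open>N1 makes the mesh finer than d, N2 moves s below the last node.\<close>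
  obtain N1 where N1: "1 / d < real N1" using reals_Archimedean2 by blast
  obtain N2 where N2: "s < real N2" using reals_Archimedean2 by blast
  show "\<exists>no. \<forall>n\<ge>no. norm (interpol n f s - f s) < \<epsilon>"
  proof (intro exI allI impI)
    fix n assume n: "max N1 N2 \<le> n"
    define j where "j = nat \<lfloor>real (n+1) * s\<rfloor>"
    define \<theta> where "\<theta> = real (n+1) * s - real j"
    have \<theta>: "0 \<le> \<theta>" "\<theta> \<le> 1" using s unfolding \<theta>_def j_def by (simp_all, linarith+)
    let ?g = "\<lambda>k. f (real k / real (n+1))"
    have "1 / d < real (n+1)" using N1 n by linarith
    then have nd: "1 / real (n+1) < d" using d(1) by (simp add: field_simps)
    have sn: "s = (real j + \<theta>) / real (n+1)" unfolding \<theta>_def by simp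
    have near: "dist (real j / real (n+1)) s \<le> 1 / real (n+1)" "dist (real (j+1) / real (n+1)) s \<le> 1 / real (n+1)"
      unfolding sn dist_real_def diff_divide_distrib[symmetric] abs_divide
      using \<theta> by (auto intro!: divide_right_mono)
    have g: "norm (?g j - f s) < \<epsilon> / 3" "norm (?g (j+1) - f s) < \<epsilon> / 3"
      unfolding dist_norm[symmetric]
      by (rule d(2)[OF _ le_less_trans[OF near(1) nd]], simp, rule d(2)[OF _ le_less_trans[OF near(2) nd]], simp)
    have "s < real (n+1)" using N2 n by linarith
    then have "interpol n f s - f s = (?g j - f s) + \<theta> *\<^sub>R ((?g (j+1) - f s) - (?g j - f s))"
      unfolding \<theta>_def using interpol_inside[OF s _ j_def] by simp
    also have "norm \<dots> \<le> norm (?g j - f s) + \<theta> * norm ((?g (j+1) - f s) - (?g j - f s))"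
      using norm_triangle_ineq[of "?g j - f s"] \<theta> by (metis abs_of_nonneg norm_scaleR)
    also have "\<dots> \<le> norm (?g j - f s) + 1 * (norm (?g (j+1) - f s) + norm (?g j - f s))"
      by (intro add_left_mono mult_mono norm_triangle_ineq4) (use \<theta> in auto)
    also have "\<dots> < \<epsilon>" using g by simp
    finally show "norm (interpol n f s - f s) < \<epsilon>" .
  qed
qed

text \<open>An interpolant is a finite sum of scalar functions times vectors, so \<Lambda> can be
  applied to its coefficients, giving vectors y n. Weak convergence alone would not produce a limit
  in the space; the estimate has to be uniform over functionals of norm at most 1, and then y is
  Cauchy.\<close>

lemma sfun_vector_integral:
  fixes f :: "real \<Rightarrow> 'a::banach"
  assumes \<Lambda>: "sfun C \<Lambda>" and f: "continuous_on {0..} f" and B: "\<And>s. 0 \<le> s \<Longrightarrow> norm (f s) \<le> B"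
  shows "\<exists>y. \<forall>\<phi>. bounded_linear \<phi> \<longrightarrow> \<phi> y = \<Lambda> (\<lambda>s. \<phi> (f s))"
proof -
  define w where "w n k s = max 0 (min 1 (real (n+1) * s - real k))" for n k and s :: real
  define v where "v n k = f (real (k+1) / real (n+1)) - f (real k / real (n+1))" for n k
  define y where "y n = \<Lambda> (\<lambda>_. 1) *\<^sub>R f 0 + (\<Sum>k<(n+1)^2. \<Lambda> (w n k) *\<^sub>R v n k)" for n
  have w: "bcont (w n k)" for n k
    unfolding w_def by (rule bcontI[where B=1]) (auto intro!: continuous_intros)
  have \<phi>f: "bcont (\<lambda>s. \<phi> (f s))" if "bounded_linear \<phi>" for \<phi> :: "'a \<Rightarrow> real"
    using f B that by (rule bcont_functional)
  have \<phi>i: "(\<lambda>s. \<phi> (interpol n f s)) = (\<lambda>s. \<phi> (f 0) * 1 + (\<Sum>k<(n+1)^2. \<phi> (v n k) * w n k s))"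
    if "bounded_linear \<phi>" for \<phi> :: "'a \<Rightarrow> real" and n
  proof -
    interpret bounded_linear \<phi> by fact
    show ?thesis by (simp add: interpol_def add sum scaleR v_def w_def mult.commute)
  qed
  have bi: "bcont (\<lambda>s. \<phi> (interpol n f s))" if "bounded_linear \<phi>" for \<phi> :: "'a \<Rightarrow> real" and n
    unfolding \<phi>i[OF that] by (intro bcont_add bcont_cmult bcont_sum bcont_const w)
  have y: "\<phi> (y n) = \<Lambda> (\<lambda>s. \<phi> (interpol n f s))" if "bounded_linear \<phi>" for \<phi> :: "'a \<Rightarrow> real" and n
  proof -
    interpret bounded_linear \<phi> by fact
    have "\<Lambda> (\<lambda>s. \<phi> (f 0) * 1 + (\<Sum>k<(n+1)^2. \<phi> (v n k) * w n k s))
        = \<phi> (f 0) * \<Lambda> (\<lambda>_. 1) + (\<Sum>k<(n+1)^2. \<phi> (v n k) * \<Lambda> (w n k))"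
      by (simp only: sfun_add[OF \<Lambda> bcont_cmult[OF bcont_const] bcont_sum[OF bcont_cmult[OF w]]]
            sfun_cmult[OF \<Lambda> bcont_const] sfun_cmult[OF \<Lambda> w] sfun_sum[OF \<Lambda> bcont_cmult[OF w]])
    then show ?thesis unfolding \<phi>i[OF that] by (simp add: y_def add sum scaleR mult.commute)
  qed
  define bad where "bad \<epsilon> n \<phi> \<longleftrightarrow> bounded_linear \<phi> \<and> (\<forall>z. \<bar>\<phi> z\<bar> \<le> norm z) \<and>
      \<epsilon> \<le> \<bar>\<phi> (y n) - \<Lambda> (\<lambda>s. \<phi> (f s))\<bar>" for \<epsilon> n and \<phi> :: "'a \<Rightarrow> real"
  have unif: "\<forall>\<^sub>F n in sequentially. \<nexists>\<phi>. bad \<epsilon> n \<phi>" if "0 < \<epsilon>" for \<epsilon>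
  proof -
    \<comment> \<open>Uniformity by choosing a worst functional for each n. Although it varies with
      n, it is dominated by the norm, so interpolant minus f still tends to 0 pointwise after
      applying it, and the limit clause of \<open>sfun\<close> excludes bad choices for large
      n.\<close>
    define \<psi> where "\<psi> n = (if \<exists>\<phi>. bad \<epsilon> n \<phi> then SOME \<phi>. bad \<epsilon> n \<phi> else (\<lambda>_. 0))" for n
    have bad\<psi>: "bad \<epsilon> n (\<psi> n)" if "\<exists>\<phi>. bad \<epsilon> n \<phi>" for n
      using someI_ex[OF that] that by (simp add: \<psi>_def)
    have \<psi>: "bounded_linear (\<psi> n)" and \<psi>1: "\<bar>\<psi> n z\<bar> \<le> norm z" for n z
      using bad\<psi>[of n] by (cases "\<exists>\<phi>. bad \<epsilon> n \<phi>"; simp add: \<psi>_def bad_def)+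
    have "(\<lambda>n. \<Lambda> (\<lambda>s. \<psi> n (interpol n f s) - \<psi> n (f s))) \<longlonglongrightarrow> \<Lambda> (\<lambda>_. 0)"
    proof (rule sfun_lim[OF \<Lambda> bcont_diff[OF bi[OF \<psi>] \<phi>f[OF \<psi>]] bcont_const])
      have diff: "\<bar>\<psi> n (interpol n f s) - \<psi> n (f s)\<bar> \<le> norm (interpol n f s - f s)" for n s
        using \<psi>1[of n "interpol n f s - f s"] by (simp add: linear_diff[OF bounded_linear.linear[OF \<psi>]])
      fix s :: real assume s: "0 \<le> s"
      show "\<bar>\<psi> n (interpol n f s) - \<psi> n (f s)\<bar> \<le> 3 * B + B" for n
        using diff[of n s] norm_triangle_ineq4[of "interpol n f s" "f s"] interpol_bound[where f=f and n=n and s=s, OF B s] B[OF s]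
        by simp
      have "(\<lambda>n. norm (interpol n f s - f s)) \<longlonglongrightarrow> 0"
        using interpol_tendsto[OF f s] by (simp add: LIM_zero_iff tendsto_norm_zero)
      then show "(\<lambda>n. \<psi> n (interpol n f s) - \<psi> n (f s)) \<longlonglongrightarrow> 0"
        by (rule Lim_null_comparison[rotated]) (simp add: diff)
    qed
    then have "\<forall>\<^sub>F n in sequentially. \<bar>\<Lambda> (\<lambda>s. \<psi> n (interpol n f s) - \<psi> n (f s))\<bar> < \<epsilon>"
      using that by (simp add: sfun_zero[OF \<Lambda>] tendsto_iff)
    then show ?thesis
    proof eventually_elim
      case (elim n)
      then have "\<not> bad \<epsilon> n (\<psi> n)"
        by (simp add: bad_def sfun_diff[OF \<Lambda> bi[OF \<psi>] \<phi>f[OF \<psi>]] y[OF \<psi>])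
      then show ?case using bad\<psi> by blast
    qed
  qed
  have "Cauchy y"
  proof (rule CauchyI)
    fix \<epsilon> :: real assume "0 < \<epsilon>"
    then obtain N where N: "\<And>n \<phi>. N \<le> n \<Longrightarrow> \<not> bad (\<epsilon>/3) n \<phi>"
      using unif[of "\<epsilon>/3"] unfolding eventually_sequentially by auto
    have "norm (y m - y n) \<le> 2 * \<epsilon> / 3" if "N \<le> m" "N \<le> n" for m n
    proof (rule norm_le_functional)
      fix \<phi> :: "'a \<Rightarrow> real" assume \<phi>: "bounded_linear \<phi>" "\<And>z. \<bar>\<phi> z\<bar> \<le> norm z"
      have "\<bar>\<phi> (y m) - \<Lambda> (\<lambda>s. \<phi> (f s))\<bar> < \<epsilon> / 3" "\<bar>\<phi> (y n) - \<Lambda> (\<lambda>s. \<phi> (f s))\<bar> < \<epsilon> / 3"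
        using N[OF that(1), of \<phi>] N[OF that(2), of \<phi>] \<phi> unfolding bad_def not_le[symmetric] by blast+
      then show "\<phi> (y m - y n) \<le> 2 * \<epsilon> / 3"
        unfolding linear_diff[OF bounded_linear.linear[OF \<phi>(1)]] by linarith
    qed
    then show "\<exists>M. \<forall>m\<ge>M. \<forall>n\<ge>M. norm (y m - y n) < \<epsilon>"
      using \<open>0 < \<epsilon>\<close> by (intro exI[of _ N]) force
  qed
  then obtain l where l: "y \<longlonglongrightarrow> l" using Cauchy_convergent_iff convergent_def by blast
  show ?thesis
  proof (intro exI allI impI)
    fix \<phi> :: "'a \<Rightarrow> real" assume \<phi>: "bounded_linear \<phi>"
    then obtain K where K: "0 \<le> K" "\<And>x. norm (\<phi> x) \<le> norm x * K"
      using bounded_linear.nonneg_bounded by blast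
    have "(\<lambda>n. \<Lambda> (\<lambda>s. \<phi> (interpol n f s))) \<longlonglongrightarrow> \<Lambda> (\<lambda>s. \<phi> (f s))"
    proof (rule sfun_lim[OF \<Lambda> bi[OF \<phi>] \<phi>f[OF \<phi>]])
      fix s :: real assume s: "0 \<le> s"
      show "\<bar>\<phi> (interpol n f s)\<bar> \<le> 3 * B * K" for n
        using order_trans[OF K(2) mult_right_mono[OF interpol_bound[OF B s] K(1)]] by simp
      show "(\<lambda>n. \<phi> (interpol n f s)) \<longlonglongrightarrow> \<phi> (f s)"
        by (rule bounded_linear.tendsto[OF \<phi> interpol_tendsto[OF f s]])
    qed
    then have "(\<lambda>n. \<phi> (y n)) \<longlonglongrightarrow> \<Lambda> (\<lambda>s. \<phi> (f s))" by (simp only: y[OF \<phi>])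
    moreover have "(\<lambda>n. \<phi> (y n)) \<longlonglongrightarrow> \<phi> l" by (rule bounded_linear.tendsto[OF \<phi> l])
    ultimately show "\<phi> l = \<Lambda> (\<lambda>s. \<phi> (f s))" by (rule LIMSEQ_unique[rotated])
  qed
qed

section \<open>The functional calculus of a bounded semigroup\<close>

lemma lap_conv:
  assumes "sfun C \<Lambda>" "sfun D \<Gamma>" "0 \<le> k"
  shows "\<Lambda> (\<lambda>s. \<Gamma> (\<lambda>u. exp (- (k * (s + u))))) = \<Lambda> (\<lambda>s. exp (- (k * s))) * \<Gamma> (\<lambda>s. exp (- (k * s)))"
proof -
  have b: "bcont (\<lambda>s. exp (- (k * s)))" using assms(3) by (rule bcont_exp)
  have "\<Gamma> (\<lambda>u. exp (- (k * (s + u)))) = \<Gamma> (\<lambda>s. exp (- (k * s))) * exp (- (k * s))" for s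
  proof -
    have "(\<lambda>u. exp (- (k * (s + u)))) = (\<lambda>u. exp (- (k * s)) * exp (- (k * u)))"
      by (auto simp: fun_eq_iff distrib_left simp flip: exp_add)
    then show ?thesis by (simp only: sfun_cmult[OF assms(2) b]) (rule mult.commute)
  qed
  then show ?thesis by (simp only: sfun_cmult[OF assms(1) b]) (rule mult.commute)
qed

locale bounded_c0_semigroup =
  fixes T :: "real \<Rightarrow> 'a::banach \<Rightarrow>\<^sub>L 'a" and M :: real
  assumes c0: "c0_semigroup T" and norm_T_le: "0 \<le> s \<Longrightarrow> norm (T s) \<le> M"
begin

lemma M_nonneg: "0 \<le> M"
  using norm_T_le[of 0] norm_ge_zero order_trans by blast

lemma T_zero: "T 0 x = x"
  using c0 by (simp add: c0_semigroup_def)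

lemma T_add: "0 \<le> s \<Longrightarrow> 0 \<le> u \<Longrightarrow> T (s + u) x = T s (T u x)"
  using c0 by (simp add: c0_semigroup_def)

lemma orbit_continuous: "continuous_on {0..} (\<lambda>s. T s x)"
  using c0 by (simp add: c0_semigroup_def)

lemma orbit_bound: "0 \<le> s \<Longrightarrow> norm (T s x) \<le> M * norm x"
  using norm_blinfun[of "T s" x] mult_right_mono[OF norm_T_le, of s "norm x"] by simp

lemma bcont_orbit: "bounded_linear \<phi> \<Longrightarrow> bcont (\<lambda>s. \<phi> (T s x))"
  using orbit_continuous orbit_bound by (rule bcont_functional)

text \<open>The operator given by integrating T(s) x against \<Lambda> in the weak sense. For an
  \<open>sfun\<close> the choice is no choice: existence is \<open>sfun_vector_integral\<close>,
  uniqueness \<open>eq_functional\<close>.\<close>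

definition hp :: "((real \<Rightarrow> real) \<Rightarrow> real) \<Rightarrow> 'a \<Rightarrow> 'a" where
  "hp \<Lambda> x = (SOME y. \<forall>\<phi>. bounded_linear \<phi> \<longrightarrow> \<phi> y = \<Lambda> (\<lambda>s. \<phi> (T s x)))"

lemma functional_hp:
  "sfun C \<Lambda> \<Longrightarrow> bounded_linear \<phi> \<Longrightarrow> \<phi> (hp \<Lambda> x) = \<Lambda> (\<lambda>s. \<phi> (T s x))"
  unfolding hp_def using someI_ex[OF sfun_vector_integral[OF _ orbit_continuous orbit_bound]] by blast

lemma hp_eqI:
  assumes "sfun C \<Lambda>" "\<And>\<phi>. bounded_linear \<phi> \<Longrightarrow> \<phi> y = \<Lambda> (\<lambda>s. \<phi> (T s x))"
  shows "hp \<Lambda> x = y"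
  by (rule eq_functional) (simp add: functional_hp[OF assms(1)] assms(2))

lemma norm_hp_le:
  assumes "sfun C \<Lambda>" shows "norm (hp \<Lambda> x) \<le> C * (M * norm x)"
proof (rule norm_le_functional)
  fix \<phi> :: "'a \<Rightarrow> real" assume \<phi>: "bounded_linear \<phi>" "\<And>z. \<bar>\<phi> z\<bar> \<le> norm z"
  have "\<bar>\<Lambda> (\<lambda>s. \<phi> (T s x))\<bar> \<le> C * (M * norm x)"
    by (rule sfun_bound[OF assms bcont_orbit[OF \<phi>(1)]]) (rule order_trans[OF \<phi>(2) orbit_bound])
  then show "\<phi> (hp \<Lambda> x) \<le> C * (M * norm x)" by (simp add: functional_hp[OF assms \<phi>(1)])
qed

lemma hp_add:
  assumes "sfun C \<Lambda>" shows "hp \<Lambda> (x + y) = hp \<Lambda> x + hp \<Lambda> y"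
  by (rule hp_eqI[OF assms])
     (simp add: blinfun.add_right linear_add[OF bounded_linear.linear] functional_hp[OF assms]
        sfun_add[OF assms bcont_orbit bcont_orbit])

lemma hp_diff:
  assumes "sfun C \<Lambda>" shows "hp \<Lambda> (x - y) = hp \<Lambda> x - hp \<Lambda> y"
  using hp_add[OF assms, of "x - y" y] by simp

lemma hp_minus_functional:
  assumes "sfun C \<Lambda>" "sfun D \<Gamma>" shows "hp (\<lambda>P. \<Lambda> P - \<Gamma> P) x = hp \<Lambda> x - hp \<Gamma> x"
  by (rule hp_eqI[OF sfun_minus[OF assms]])
     (simp add: linear_diff[OF bounded_linear.linear] functional_hp[OF assms(1)] functional_hp[OF assms(2)])

lemma hp_scale_functional:
  assumes "sfun C \<Lambda>" shows "hp (\<lambda>P. c * \<Lambda> P) x = c *\<^sub>R hp \<Lambda> x"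
  by (rule hp_eqI[OF sfun_scale[OF assms]])
     (simp add: linear_scale[OF bounded_linear.linear] functional_hp[OF assms(1)])

lemma hp_eval: "0 \<le> t \<Longrightarrow> hp (\<lambda>P. P t) x = T t x"
  by (rule hp_eqI[OF sfun_eval]) auto

lemma hp_intertwine:
  assumes "sfun C \<Lambda>" "bounded_linear S" "\<And>s. 0 \<le> s \<Longrightarrow> T s (S x) = S (T s x)"
  shows "hp \<Lambda> (S x) = S (hp \<Lambda> x)"
proof (rule hp_eqI[OF assms(1)])
  fix \<phi> :: "'a \<Rightarrow> real" assume \<phi>: "bounded_linear \<phi>"
  then have \<phi>S: "bounded_linear (\<lambda>x. \<phi> (S x))" by (rule bounded_linear_compose[OF _ assms(2)])
  have "\<phi> (S (hp \<Lambda> x)) = \<Lambda> (\<lambda>s. \<phi> (S (T s x)))"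
    by (rule functional_hp[OF assms(1) \<phi>S])
  also have "\<dots> = \<Lambda> (\<lambda>s. \<phi> (T s (S x)))"
    by (rule sfun_cong[OF assms(1) bcont_orbit[OF \<phi>S] bcont_orbit[OF \<phi>]]) (simp add: assms(3))
  finally show "\<phi> (S (hp \<Lambda> x)) = \<Lambda> (\<lambda>s. \<phi> (T s (S x)))" .
qed

text \<open>Composing \<phi> with T s gives another continuous functional, so T s can be moved under
  the inner functional; the semigroup law then turns the iterated expression into the
  convolution.\<close>

lemma hp_hp:
  assumes "sfun C \<Lambda>" "sfun D \<Gamma>"
  shows "hp \<Lambda> (hp \<Gamma> x) = hp (\<lambda>P. \<Lambda> (\<lambda>s. \<Gamma> (\<lambda>u. P (s + u)))) x"
proof (rule sym, rule hp_eqI[OF sfun_conv[OF assms]])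
  fix \<phi> :: "'a \<Rightarrow> real" assume \<phi>: "bounded_linear \<phi>"
  have "\<phi> (T s (hp \<Gamma> x)) = \<Gamma> (\<lambda>u. \<phi> (T (s + u) x))" if s: "0 \<le> s" for s
  proof -
    have b: "bounded_linear (\<lambda>x. \<phi> (T s x))"
      by (rule bounded_linear_compose[OF \<phi> blinfun.bounded_linear_right])
    have "\<phi> (T s (hp \<Gamma> x)) = \<Gamma> (\<lambda>u. \<phi> (T s (T u x)))" by (rule functional_hp[OF assms(2) b])
    also have "\<dots> = \<Gamma> (\<lambda>u. \<phi> (T (s + u) x))"
      by (rule sfun_cong[OF assms(2) bcont_orbit[OF b] bcont_shift'[OF bcont_orbit[OF \<phi>] s]])
         (simp add: T_add s)
    finally show ?thesis .
  qed
  then have "\<Lambda> (\<lambda>s. \<phi> (T s (hp \<Gamma> x))) = \<Lambda> (\<lambda>s. \<Gamma> (\<lambda>u. \<phi> (T (s + u) x)))"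
    by (rule sfun_cong[OF assms(1) bcont_orbit[OF \<phi>] bcont_conv[OF assms(2) bcont_orbit[OF \<phi>]]])
  then show "\<phi> (hp \<Lambda> (hp \<Gamma> x)) = \<Lambda> (\<lambda>s. \<Gamma> (\<lambda>u. \<phi> (T (s + u) x)))"
    by (simp only: functional_hp[OF assms(1) \<phi>])
qed

text \<open>The reduction of operator identities to scalar ones: both products are convolutions with
  the same transform, hence the same functional. Commutativity and all later exchanges of operators
  are instances.\<close>

lemma hp_prod_eq:
  assumes "sfun C \<Lambda>" "sfun D \<Gamma>" "sfun C' \<Lambda>'" "sfun D' \<Gamma>'"
    and "\<And>k. 0 < k \<Longrightarrow> \<Lambda> (\<lambda>s. exp (- (k * s))) * \<Gamma> (\<lambda>s. exp (- (k * s)))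
        = \<Lambda>' (\<lambda>s. exp (- (k * s))) * \<Gamma>' (\<lambda>s. exp (- (k * s)))"
  shows "hp \<Lambda> (hp \<Gamma> x) = hp \<Lambda>' (hp \<Gamma>' x)"
  unfolding hp_hp[OF assms(1,2)] hp_hp[OF assms(3,4)]
proof (rule hp_eqI[OF sfun_conv[OF assms(1,2)]])
  fix \<phi> :: "'a \<Rightarrow> real" assume \<phi>: "bounded_linear \<phi>"
  show "\<phi> (hp (\<lambda>P. \<Lambda>' (\<lambda>s. \<Gamma>' (\<lambda>u. P (s + u)))) x) = \<Lambda> (\<lambda>s. \<Gamma> (\<lambda>u. \<phi> (T (s + u) x)))"
    unfolding functional_hp[OF sfun_conv[OF assms(3,4)] \<phi>]
    by (rule sfun_unique[OF sfun_conv[OF assms(3,4)] sfun_conv[OF assms(1,2)] bcont_orbit[OF \<phi>]])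
       (simp add: lap_conv[OF assms(1,2)] lap_conv[OF assms(3,4)] assms(5))
qed

lemma hp_commute:
  assumes "sfun C \<Lambda>" "sfun D \<Gamma>"
  shows "hp \<Lambda> (hp \<Gamma> x) = hp \<Gamma> (hp \<Lambda> x)"
  by (rule hp_prod_eq[OF assms assms(2,1)]) (rule mult.commute)

end

section \<open>Concrete functionals\<close>

lemma sfun_integral:
  assumes "finite_measure m" and sets: "sets m = sets (restrict_space borel {0::real..})"
  shows "sfun (measure m (space m)) (\<lambda>P. \<integral>s. P s \<partial>m)" "bcont P \<Longrightarrow> integrable m P"
proof -
  interpret finite_measure m by fact
  have space: "space m = {0..}" using sets_eq_imp_space_eq[OF sets] by (simp add: space_restrict_space)
  have meas: "P \<in> borel_measurable m" if "bcont P" for P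
    using borel_measurable_continuous_on_restrict[of "{0..}" P] that measurable_cong_sets[OF sets refl]
    by (auto simp: bcont_def)
  have int: "integrable m P" if P: "bcont P" for P
  proof -
    obtain B where "\<And>s. 0 \<le> s \<Longrightarrow> \<bar>P s\<bar> \<le> B" using P by (rule bcontE) blast
    then show ?thesis
      by (intro integrable_const_bound[where B=B] meas P) (auto simp: space intro!: AE_I2)
  qed
  then show "bcont P \<Longrightarrow> integrable m P" .
  show "sfun (measure m (space m)) (\<lambda>P. \<integral>s. P s \<partial>m)"
  proof (rule sfunI)
    fix P B assume P: "bcont P" "\<And>s. 0 \<le> s \<Longrightarrow> \<bar>P s\<bar> \<le> B"
    have "\<bar>\<integral>s. P s \<partial>m\<bar> \<le> (\<integral>s. \<bar>P s\<bar> \<partial>m)" by (rule integral_abs_bound)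
    also have "\<dots> \<le> (\<integral>s. B \<partial>m)"
      by (rule integral_mono) (use int[OF P(1)] P(2) space in auto)
    finally show "\<bar>\<integral>s. P s \<partial>m\<bar> \<le> measure m (space m) * B" by simp
  next
    fix Q :: "nat \<Rightarrow> real \<Rightarrow> real" and P B
    assume *: "\<And>n. bcont (Q n)" "bcont P" "\<And>n s. 0 \<le> s \<Longrightarrow> \<bar>Q n s\<bar> \<le> B"
      "\<And>s. 0 \<le> s \<Longrightarrow> (\<lambda>n. Q n s) \<longlonglongrightarrow> P s"
    show "(\<lambda>n. \<integral>s. Q n s \<partial>m) \<longlonglongrightarrow> (\<integral>s. P s \<partial>m)"
      by (rule integral_dominated_convergence[where w="\<lambda>_. B"]) (use * meas space in auto)
  qed (use int in auto)
qed

lemma bcont_integrable_on: "bcont P \<Longrightarrow> 0 \<le> c \<Longrightarrow> P integrable_on {c..d}"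
  unfolding bcont_def by (intro integrable_continuous_interval) (auto elim: continuous_on_subset)

lemma sfun_integral_interval:
  assumes "0 \<le> t" shows "sfun t (\<lambda>P. integral {0..t} P)"
proof (rule sfunI)
  fix P B assume P: "bcont P" "\<And>s. 0 \<le> s \<Longrightarrow> \<bar>P s\<bar> \<le> B"
  have "continuous_on {0..t} P" using P(1) by (auto simp: bcont_def intro: continuous_on_subset)
  then show "\<bar>integral {0..t} P\<bar> \<le> t * B"
    using integral_bound[of 0 t P B] assms P(2) by (simp add: mult.commute)
next
  fix Q :: "nat \<Rightarrow> real \<Rightarrow> real" and P B
  assume *: "\<And>n. bcont (Q n)" "bcont P" "\<And>n s. 0 \<le> s \<Longrightarrow> \<bar>Q n s\<bar> \<le> B"
    "\<And>s. 0 \<le> s \<Longrightarrow> (\<lambda>n. Q n s) \<longlonglongrightarrow> P s"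
  show "(\<lambda>n. integral {0..t} (Q n)) \<longlonglongrightarrow> integral {0..t} P"
    by (rule dominated_convergence(2)[where h="\<lambda>_. B"]) (use * bcont_integrable_on in auto)
qed (use assms bcont_integrable_on in \<open>auto simp: integral_add\<close>)

lemma integral_exp_interval:
  fixes k t :: real
  assumes "0 < k" "0 \<le> t"
  shows "integral {0..t} (\<lambda>s. exp (- (k * s))) = (1 - exp (- (k * t))) / k"
proof -
  have "((\<lambda>s. exp (- (k * s))) has_integral (- exp (- (k * t)) / k) - (- exp (- (k * 0)) / k)) {0..t}"
    by (rule fundamental_theorem_of_calculus[where f="\<lambda>s. - exp (- (k * s)) / k"])
       (use assms in \<open>auto intro!: derivative_eq_intros simp flip: has_real_derivative_iff_has_vector_derivative\<close>)
  then show ?thesis by (simp add: integral_unique diff_divide_distrib)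
qed

definition mean_fun :: "real \<Rightarrow> (real \<Rightarrow> real) \<Rightarrow> real" where
  "mean_fun t P = (1 / t) * integral {0..t} P"

lemma sfun_mean: "0 < t \<Longrightarrow> sfun 1 (mean_fun t)"
  using sfun_scale[OF sfun_integral_interval, of t "1/t"] by (simp add: mean_fun_def[abs_def])

lemma (in bounded_c0_semigroup) hp_mean:
  assumes "0 < t" shows "hp (mean_fun t) x = cesaro T t x"
proof (rule hp_eqI[OF sfun_mean[OF assms]])
  fix \<phi> :: "'a \<Rightarrow> real" assume \<phi>: "bounded_linear \<phi>"
  have "(\<lambda>s. T s x) integrable_on {0..t}"
    by (intro integrable_continuous_interval continuous_on_subset[OF orbit_continuous]) auto
  then have "integral {0..t} (\<phi> \<circ> (\<lambda>s. T s x)) = \<phi> (integral {0..t} (\<lambda>s. T s x))"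
    using \<phi> by (rule integral_linear)
  then show "\<phi> (cesaro T t x) = mean_fun t (\<lambda>s. \<phi> (T s x))"
    by (simp add: cesaro_def mean_fun_def linear_scale[OF bounded_linear.linear[OF \<phi>]] comp_def)
qed

text \<open>The bridge from integrals against finite measures to functionals; the integrability
  demanded by \<open>vint\<close> is automatic for orbits of a bounded semigroup.\<close>

lemma (in bounded_c0_semigroup) vint_iff_hp:
  assumes "fin_meas0 m"
  shows "vint m (\<lambda>s. T s x) y \<longleftrightarrow> y = hp (\<lambda>P. \<integral>s. P s \<partial>m) x"
proof -
  have m: "sfun (measure m (space m)) (\<lambda>P. \<integral>s. P s \<partial>m)" and int: "\<And>P. bcont P \<Longrightarrow> integrable m P"
    using assms sfun_integral unfolding fin_meas0_def by blast+
  show ?thesis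
  proof
    assume "vint m (\<lambda>s. T s x) y"
    then show "y = hp (\<lambda>P. \<integral>s. P s \<partial>m) x"
      by (intro hp_eqI[OF m, symmetric]) (simp add: vint_def)
  next
    assume "y = hp (\<lambda>P. \<integral>s. P s \<partial>m) x"
    then show "vint m (\<lambda>s. T s x) y"
      by (auto simp: vint_def functional_hp[OF m] intro: int bcont_orbit)
  qed
qed

text \<open>\<mu> may have infinite mass near 0, so it is not itself an \<open>sfun\<close>.
  Integrability of the variations c s is what is needed: c s * B dominates all integrands.\<close>

lemma sfun_mixture:
  assumes \<Phi>: "\<And>s. s \<in> space \<mu> \<Longrightarrow> sfun (c s) (\<Phi> s)"
    and meas: "\<And>P. bcont P \<Longrightarrow> (\<lambda>s. \<Phi> s P) \<in> borel_measurable \<mu>"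
    and c: "integrable \<mu> c"
  shows "sfun (\<integral>s. c s \<partial>\<mu>) (\<lambda>P. \<integral>s. \<Phi> s P \<partial>\<mu>)"
proof -
  have c0: "0 \<le> c s" if "s \<in> space \<mu>" for s using sfun_nonneg[OF \<Phi>[OF that]] .
  have int: "integrable \<mu> (\<lambda>s. \<Phi> s P)" if P: "bcont P" for P
  proof -
    obtain B where B: "0 \<le> B" "\<And>s. 0 \<le> s \<Longrightarrow> \<bar>P s\<bar> \<le> B" using P by (rule bcontE) blast
    show ?thesis
    proof (rule Bochner_Integration.integrable_bound[OF _ meas[OF P]])
      show "integrable \<mu> (\<lambda>s. c s * B)" using c by simp
      show "AE s in \<mu>. norm (\<Phi> s P) \<le> norm (c s * B)"
      proof (rule AE_I2)
        fix s assume s: "s \<in> space \<mu>"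
        show "norm (\<Phi> s P) \<le> norm (c s * B)"
          using sfun_bound[OF \<Phi>[OF s] P B(2)] by simp
      qed
    qed
  qed
  show ?thesis
  proof (rule sfunI)
    show "0 \<le> (\<integral>s. c s \<partial>\<mu>)" using c0 by (rule Bochner_Integration.integral_nonneg)
  next
    fix P Q assume P: "bcont P" and Q: "bcont Q"
    have "(\<integral>s. \<Phi> s (\<lambda>s. P s + Q s) \<partial>\<mu>) = (\<integral>s. \<Phi> s P + \<Phi> s Q \<partial>\<mu>)"
      by (rule Bochner_Integration.integral_cong[OF refl]) (rule sfun_add[OF \<Phi> P Q])
    then show "(\<integral>s. \<Phi> s (\<lambda>s. P s + Q s) \<partial>\<mu>) = (\<integral>s. \<Phi> s P \<partial>\<mu>) + (\<integral>s. \<Phi> s Q \<partial>\<mu>)"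
      using int[OF P] int[OF Q] by simp
  next
    fix d P assume P: "bcont P"
    have "(\<integral>s. \<Phi> s (\<lambda>s. d * P s) \<partial>\<mu>) = (\<integral>s. d * \<Phi> s P \<partial>\<mu>)"
      by (rule Bochner_Integration.integral_cong[OF refl]) (rule sfun_cmult[OF \<Phi> P])
    then show "(\<integral>s. \<Phi> s (\<lambda>s. d * P s) \<partial>\<mu>) = d * (\<integral>s. \<Phi> s P \<partial>\<mu>)" by simp
  next
    fix P B assume P: "bcont P" "\<And>s. 0 \<le> s \<Longrightarrow> \<bar>P s\<bar> \<le> B"
    have "\<bar>\<integral>s. \<Phi> s P \<partial>\<mu>\<bar> \<le> (\<integral>s. \<bar>\<Phi> s P\<bar> \<partial>\<mu>)" by (rule integral_abs_bound)
    also have "\<dots> \<le> (\<integral>s. c s * B \<partial>\<mu>)"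
      by (rule integral_mono) (use int[OF P(1)] c sfun_bound[OF \<Phi> P] in auto)
    finally show "\<bar>\<integral>s. \<Phi> s P \<partial>\<mu>\<bar> \<le> (\<integral>s. c s \<partial>\<mu>) * B" by simp
  next
    fix Q :: "nat \<Rightarrow> real \<Rightarrow> real" and P B
    assume *: "\<And>n. bcont (Q n)" "bcont P" "\<And>n s. 0 \<le> s \<Longrightarrow> \<bar>Q n s\<bar> \<le> B"
      "\<And>s. 0 \<le> s \<Longrightarrow> (\<lambda>n. Q n s) \<longlonglongrightarrow> P s"
    show "(\<lambda>n. \<integral>s. \<Phi> s (Q n) \<partial>\<mu>) \<longlonglongrightarrow> (\<integral>s. \<Phi> s P \<partial>\<mu>)"
    proof (rule integral_dominated_convergence[where w="\<lambda>s. c s * B"])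
      show "AE s in \<mu>. (\<lambda>n. \<Phi> s (Q n)) \<longlonglongrightarrow> \<Phi> s P"
        by (rule AE_I2) (rule sfun_lim[OF \<Phi> *])
      show "AE s in \<mu>. norm (\<Phi> s (Q n)) \<le> c s * B" for n
        unfolding real_norm_def by (rule AE_I2) (rule sfun_bound[OF \<Phi> *(1) *(3)])
    qed (use meas * c in auto)
  qed
qed

section \<open>Levy measures, the rate function and the functionals built from them\<close>

lemma levy_space: "levy_measure \<mu> \<Longrightarrow> space \<mu> = {0<..}"
  unfolding levy_measure_def by (metis sets_eq_imp_space_eq space_restrict_space space_borel Int_UNIV_right)

lemma levy_measurable:
  fixes f :: "real \<Rightarrow> real"
  assumes "levy_measure \<mu>" "continuous_on {0<..} f" shows "f \<in> borel_measurable \<mu>"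
  using borel_measurable_continuous_on_restrict[OF assms(2)]
    measurable_cong_sets[of \<mu> "restrict_space borel {0<..}" borel borel] assms(1)
  by (auto simp: levy_measure_def)

lemma levy_integrable_min:
  assumes mu: "levy_measure \<mu>" and t: "0 < t"
  shows "integrable \<mu> (\<lambda>s. min s t)"
proof (rule Bochner_Integration.integrable_bound)
  show "integrable \<mu> (\<lambda>s. (1 + t) * (s / (1 + s)))"
    using mu unfolding levy_measure_def by (intro integrable_mult_right) blast
  show "(\<lambda>s. min s t) \<in> borel_measurable \<mu>"
    by (rule levy_measurable[OF mu]) (intro continuous_intros)
  show "AE s in \<mu>. norm (min s t) \<le> norm ((1 + t) * (s / (1 + s)))"
  proof (rule AE_I2)
    fix s assume "s \<in> space \<mu>"
    then have s: "0 < s" using levy_space[OF mu] by simp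
    have "min s t * (1 + s) \<le> (1 + t) * s"
    proof (cases "s \<le> t")
      case True
      then have "s * s \<le> t * s" using s by (intro mult_right_mono) auto
      then show ?thesis using True by (simp add: min_def algebra_simps)
    qed (use t in \<open>simp add: min_def algebra_simps\<close>)
    then show "norm (min s t) \<le> norm ((1 + t) * (s / (1 + s)))"
      using s t by (simp add: pos_le_divide_eq)
  qed
qed

text \<open>After multiplication by t the rate shows a truncated first moment of \<mu>, the form
  used both for the variation bound and for the case of bounded t r(t).\<close>

lemma integral_min_rate:
  assumes "0 < t"
  shows "t * rate a b \<mu> t = a * t / 2 + b + (\<integral>s. min s t \<partial>\<mu>)"
proof -
  have "min (s / t) 1 = (1 / t) * min s t" for s using assms by (auto simp: min_def field_simps)
  then have "(\<integral>s. min (s / t) 1 \<partial>\<mu>) = (1 / t) * (\<integral>s. min s t \<partial>\<mu>)"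
    by (simp only: integral_mult_right_zero)
  then show ?thesis using assms by (simp add: rate_def distrib_left)
qed

text \<open>Convolving Lebesgue measure on [0, s] with the difference of the point masses at 0 and t
  gives variation at most 2 s. The result is symmetric in s and t, so 2 t is a bound as well, and
  this produces the minimum in the rate.\<close>

lemma sfun_increment:
  assumes "0 \<le> s" "0 \<le> t"
  shows "sfun (2 * min s t) (\<lambda>P. integral {0..s} (\<lambda>u. P u - P (u + t)))"
proof -
  have 1: "sfun (s * (1 + 1)) (\<lambda>P. integral {0..s} (\<lambda>u. P (u + 0) - P (u + t)))"
    by (rule sfun_conv[OF sfun_integral_interval[OF assms(1)] sfun_minus[OF sfun_eval sfun_eval]]) (use assms in auto)
  have 2: "sfun (t * (1 + 1)) (\<lambda>P. integral {0..t} (\<lambda>u. P (u + 0) - P (u + s)))"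
    by (rule sfun_conv[OF sfun_integral_interval[OF assms(2)] sfun_minus[OF sfun_eval sfun_eval]]) (use assms in auto)
  \<comment> \<open>Both sides equal the integral over [0, s] plus that over [0, t] minus that over
    [0, s + t].\<close>
  have swap: "integral {0..s} (\<lambda>u. P u - P (u + t)) = integral {0..t} (\<lambda>u. P u - P (u + s))"
    if P: "bcont P" for P
  proof -
    have int: "P integrable_on {x..y}" if "0 \<le> x" for x y using bcont_integrable_on[OF P that] .
    have shift: "integral {0..x} (\<lambda>u. P (u + y)) = integral {y..x + y} P" for x y
      using integral_shift_real_ivl[where a=y and b="x + y" and c=y and f=P] by simp
    have sh: "(\<lambda>u. P (u + y)) integrable_on {0..x}" if "0 \<le> y" for x y
      using bcont_integrable_on[OF bcont_shift[OF P that]] by simp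
    have D: "integral {0..x} (\<lambda>u. P u - P (u + y)) = integral {0..x} P - integral {y..x + y} P"
      if "0 \<le> y" for x y
      using Henstock_Kurzweil_Integration.integral_diff[OF int[OF order.refl] sh[OF that], of x] shift by simp
    moreover have "integral {0..s} P + integral {s..s + t} P = integral {0..s + t} P"
      "integral {0..t} P + integral {t..s + t} P = integral {0..s + t} P"
      by (rule Henstock_Kurzweil_Integration.integral_combine; use assms int in simp)+
    ultimately show ?thesis
      unfolding D[OF assms(1)] D[OF assms(2)] add.commute[of t s] by linarith
  qed
  show ?thesis
  proof (rule sfunI)
    fix P B assume P: "bcont P" "\<And>s. 0 \<le> s \<Longrightarrow> \<bar>P s\<bar> \<le> B"
    show "\<bar>integral {0..s} (\<lambda>u. P u - P (u + t))\<bar> \<le> 2 * min s t * B"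
      using sfun_bound[OF 1 P] sfun_bound[OF 2 P] swap[OF P(1)] by (simp add: min_def mult.commute)
  next
    fix Q :: "nat \<Rightarrow> real \<Rightarrow> real" and P B
    assume *: "\<And>n. bcont (Q n)" "bcont P" "\<And>n s. 0 \<le> s \<Longrightarrow> \<bar>Q n s\<bar> \<le> B"
      "\<And>s. 0 \<le> s \<Longrightarrow> (\<lambda>n. Q n s) \<longlonglongrightarrow> P s"
    show "(\<lambda>n. integral {0..s} (\<lambda>u. Q n u - Q n (u + t))) \<longlonglongrightarrow> integral {0..s} (\<lambda>u. P u - P (u + t))"
      using sfun_lim[OF 1 *] by simp
  next
    fix P Q assume "bcont P" "bcont Q"
    from sfun_add[OF 1 this]
    show "integral {0..s} (\<lambda>u. P u + Q u - (P (u + t) + Q (u + t)))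
        = integral {0..s} (\<lambda>u. P u - P (u + t)) + integral {0..s} (\<lambda>u. Q u - Q (u + t))" by simp
  next
    fix c P assume "bcont P"
    from sfun_cmult[OF 1 this, of c]
    show "integral {0..s} (\<lambda>u. c * P u - c * P (u + t)) = c * integral {0..s} (\<lambda>u. P u - P (u + t))"
      by simp
  qed (use assms in simp)
qed

text \<open>Supplies measurability in s of the kernels integrated against \<mu>, whose carrier is
  the open half-line.\<close>

lemma continuous_on_indefinite_integral:
  assumes "bcont P" shows "continuous_on {0<..} (\<lambda>s. integral {0..s} P)"
proof -
  have "isCont (\<lambda>s. integral {0..s} P) x" if "0 < x" for x
  proof -
    have "continuous_on {0..x + 1} (\<lambda>s. integral {0..s} P)"
      by (rule indefinite_integral_continuous_1[OF bcont_integrable_on[OF assms]]) simp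
    then show ?thesis by (rule continuous_on_interior) (use that in \<open>simp add: interior_atLeastAtMost_real\<close>)
  qed
  then show ?thesis by (intro continuous_at_imp_continuous_on) auto
qed

text \<open>With \<open>g\<close> the Bernstein function of \<open>(a, b, \<mu>)\<close>, this functional has Laplace transform
  \<open>g(k) (1 - exp (- k t)) / (k t)\<close>: the last summand comes from
  \<open>(1 - exp (- k s)) (1 - exp (- k t)) / k\<close> being the transform of
  the difference of the indicator functions of \<open>[0, s]\<close> and \<open>[t, s + t]\<close>.\<close>

definition levy_fun :: "real \<Rightarrow> real \<Rightarrow> real measure \<Rightarrow> real \<Rightarrow> (real \<Rightarrow> real) \<Rightarrow> real" where
  "levy_fun a b \<mu> t P = (a * mean_fun t P + b / t * (P 0 - P t)) +
     1 / t * (\<integral>s. integral {0..s} (\<lambda>u. P u - P (u + t)) \<partial>\<mu>)"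

definition bernstein_real :: "real \<Rightarrow> real \<Rightarrow> real measure \<Rightarrow> real \<Rightarrow> real" where
  "bernstein_real a b \<mu> k = a + b * k + (\<integral>s. 1 - exp (- (k * s)) \<partial>\<mu>)"

lemma bernstein_of_real: "bernstein a b \<mu> (of_real k) = of_real (bernstein_real a b \<mu> k)"
proof -
  have "1 - exp (- (of_real s * of_real k)) = complex_of_real (1 - exp (- (k * s)))" for s
    by (simp add: exp_of_real[symmetric] mult.commute)
  then have "(\<integral>s. 1 - exp (- (of_real s * of_real k)) \<partial>\<mu>) = complex_of_real (\<integral>s. 1 - exp (- (k * s)) \<partial>\<mu>)"
    by (simp only: integral_complex_of_real)
  then show ?thesis by (simp add: bernstein_def bernstein_real_def)
qed

text \<open>Adding variations explains the rate: the mean contributes a, which is twice a / 2, the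
  two point masses contribute 2 b / t, and the increments 2 / t times the integral of min s
  t.\<close>

lemma sfun_levy:
  assumes ab: "0 \<le> a" "0 \<le> b" and mu: "levy_measure \<mu>" and t: "0 < t"
  shows "sfun (2 * rate a b \<mu> t) (levy_fun a b \<mu> t)"
proof -
  have "sfun (\<integral>s. 2 * min s t \<partial>\<mu>) (\<lambda>P. \<integral>s. integral {0..s} (\<lambda>u. P u - P (u + t)) \<partial>\<mu>)"
  proof (rule sfun_mixture)
    show "sfun (2 * min s t) (\<lambda>P. integral {0..s} (\<lambda>u. P u - P (u + t)))" if "s \<in> space \<mu>" for s
      by (rule sfun_increment) (use that t levy_space[OF mu] in auto)
    show "(\<lambda>s. integral {0..s} (\<lambda>u. P u - P (u + t))) \<in> borel_measurable \<mu>" if P: "bcont P" for P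
      by (intro levy_measurable[OF mu] continuous_on_indefinite_integral bcont_diff P bcont_shift less_imp_le[OF t])
    show "integrable \<mu> (\<lambda>s. 2 * min s t)" using levy_integrable_min[OF mu t] by simp
  qed
  from sfun_scale[OF this, of "1 / t"]
  have 3: "sfun (\<bar>1 / t\<bar> * (\<integral>s. 2 * min s t \<partial>\<mu>)) (\<lambda>P. 1 / t * (\<integral>s. integral {0..s} (\<lambda>u. P u - P (u + t)) \<partial>\<mu>))" .
  have 2: "sfun (\<bar>b / t\<bar> * (1 + 1)) (\<lambda>P. b / t * (P 0 - P t))"
    by (intro sfun_scale sfun_minus sfun_eval) (use t in auto)
  have 1: "sfun (\<bar>a\<bar> * 1) (\<lambda>P. a * mean_fun t P)" by (rule sfun_scale[OF sfun_mean[OF t]])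
  have "t * (\<bar>a\<bar> * 1 + \<bar>b / t\<bar> * (1 + 1) + \<bar>1 / t\<bar> * (\<integral>s. 2 * min s t \<partial>\<mu>)) = t * (2 * rate a b \<mu> t)"
    using integral_min_rate[OF t, of a b \<mu>] ab t by (simp add: field_simps)
  then show ?thesis
    using sfun_plus[OF sfun_plus[OF 1 2] 3] t by (simp add: levy_fun_def[abs_def])
qed

lemma mean_lap:
  assumes "0 < t" "0 < k"
  shows "mean_fun t (\<lambda>s. exp (- (k * s))) = (1 - exp (- (k * t))) / (k * t)"
  using integral_exp_interval[of k t] assms by (simp add: mean_fun_def mult.commute)

lemma levy_lap:
  assumes t: "0 < t" and k: "0 < k" and mu: "levy_measure \<mu>"
  shows "levy_fun a b \<mu> t (\<lambda>s. exp (- (k * s))) = bernstein_real a b \<mu> k * ((1 - exp (- (k * t))) / (k * t))"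
proof -
  have "integral {0..s} (\<lambda>u. exp (- (k * u)) - exp (- (k * (u + t)))) = (1 - exp (- (k * s))) * ((1 - exp (- (k * t))) / k)"
    if "0 < s" for s
  proof -
    have "(\<lambda>u. exp (- (k * u)) - exp (- (k * (u + t)))) = (\<lambda>u. (1 - exp (- (k * t))) * exp (- (k * u)))"
      by (auto simp: fun_eq_iff algebra_simps simp flip: exp_add)
    then show ?thesis using integral_exp_interval[OF k, of s] that by simp
  qed
  then have "(\<integral>s. integral {0..s} (\<lambda>u. exp (- (k * u)) - exp (- (k * (u + t)))) \<partial>\<mu>)
      = (\<integral>s. (1 - exp (- (k * s))) * ((1 - exp (- (k * t))) / k) \<partial>\<mu>)"
    by (intro Bochner_Integration.integral_cong[OF refl]) (simp add: levy_space[OF mu])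
  also have "\<dots> = (\<integral>s. 1 - exp (- (k * s)) \<partial>\<mu>) * ((1 - exp (- (k * t))) / k)"
    by (rule integral_mult_left_zero)
  finally have *: "(\<integral>s. integral {0..s} (\<lambda>u. exp (- (k * u)) - exp (- (k * (u + t)))) \<partial>\<mu>)
      = (\<integral>s. 1 - exp (- (k * s)) \<partial>\<mu>) * ((1 - exp (- (k * t))) / k)" .
  show ?thesis
    unfolding levy_fun_def * mean_lap[OF t k] bernstein_real_def using t k by (simp add: field_simps)
qed

text \<open>This is \<kappa>: after exchanging the integrals, it has an atom b at 0 and the tail of
  \<mu>, the mass of (u,\<infinity>), as density at u. The iterated form spares the
  exchange.\<close>

definition potential_fun :: "real \<Rightarrow> real measure \<Rightarrow> (real \<Rightarrow> real) \<Rightarrow> real" where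
  "potential_fun b \<mu> P = b * P 0 + (\<integral>s. integral {0..s} P \<partial>\<mu>)"

lemma sfun_potential:
  assumes mu: "levy_measure \<mu>" and int: "integrable \<mu> (\<lambda>s. s)"
  shows "\<exists>C. sfun C (potential_fun b \<mu>)"
proof -
  have "sfun (\<integral>s. s \<partial>\<mu>) (\<lambda>P. \<integral>s. integral {0..s} P \<partial>\<mu>)"
  proof (rule sfun_mixture)
    show "sfun s (\<lambda>P. integral {0..s} P)" if "s \<in> space \<mu>" for s
      by (rule sfun_integral_interval) (use that levy_space[OF mu] in auto)
    show "(\<lambda>s. integral {0..s} P) \<in> borel_measurable \<mu>" if P: "bcont P" for P
      by (intro levy_measurable[OF mu] continuous_on_indefinite_integral P)
  qed fact
  from sfun_plus[OF sfun_scale[OF sfun_eval[of 0], of b] this] show ?thesis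
    by (auto simp: potential_fun_def[abs_def])
qed

lemma potential_lap:
  assumes k: "0 < k" and mu: "levy_measure \<mu>"
  shows "potential_fun b \<mu> (\<lambda>s. exp (- (k * s))) = bernstein_real 0 b \<mu> k / k"
proof -
  have "(\<integral>s. integral {0..s} (\<lambda>u. exp (- (k * u))) \<partial>\<mu>) = (\<integral>s. (1 - exp (- (k * s))) / k \<partial>\<mu>)"
    by (intro Bochner_Integration.integral_cong[OF refl])
       (simp add: levy_space[OF mu] integral_exp_interval[OF k])
  then show ?thesis using k by (simp add: potential_fun_def bernstein_real_def field_simps)
qed

text \<open>At real points the four integrals are real, so the two signed pairs can be read off as
  real and imaginary part.\<close>

lemma laplace_of_real:
  "laplace (n1, n2, n3, n4) (of_real k) =
     Complex ((\<integral>s. exp (- (k * s)) \<partial>n1) - (\<integral>s. exp (- (k * s)) \<partial>n2))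
             ((\<integral>s. exp (- (k * s)) \<partial>n3) - (\<integral>s. exp (- (k * s)) \<partial>n4))"
proof -
  have "exp (- (of_real s * of_real k)) = complex_of_real (exp (- (k * s)))" for s
    by (simp add: exp_of_real[symmetric] mult.commute)
  then have "(\<integral>s. exp (- (of_real s * of_real k)) \<partial>m) = complex_of_real (\<integral>s. exp (- (k * s)) \<partial>m)" for m
    by (simp only: integral_complex_of_real)
  then show ?thesis by (simp add: laplace_def complex_eq_iff)
qed

section \<open>Cesaro means on the range of a Bernstein function of the generator\<close>

lemma sfun_difference: "0 \<le> t \<Longrightarrow> sfun 2 (\<lambda>P. P 0 - P t)"
  using sfun_minus[OF sfun_eval[of 0] sfun_eval[of t]] by simp

context bounded_c0_semigroup
begin

lemma hp_difference: "0 \<le> t \<Longrightarrow> hp (\<lambda>P. P 0 - P t) x = x - T t x"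
  using hp_minus_functional[OF sfun_eval[of 0] sfun_eval[of t], of x] by (simp add: hp_eval T_zero)

text \<open>For genuine measures \<open>hp_op\<close> is the graph of an everywhere defined map, so
  \<open>hp_injective\<close> really allows e(A) to be cancelled.\<close>

lemma hp_op_iff:
  assumes "cmeas (n1, n2, n3, n4)"
  shows "hp_op T J (n1, n2, n3, n4) x y \<longleftrightarrow>
    y = hp (\<lambda>P. (\<integral>s. P s \<partial>n1) - (\<integral>s. P s \<partial>n2)) x + J (hp (\<lambda>P. (\<integral>s. P s \<partial>n3) - (\<integral>s. P s \<partial>n4)) x)"
proof -
  have m: "fin_meas0 n1" "fin_meas0 n2" "fin_meas0 n3" "fin_meas0 n4"
    using assms by (auto simp: cmeas_def)
  then have s: "sfun (measure n (space n)) (\<lambda>P. \<integral>s. P s \<partial>n)" if "n \<in> {n1, n2, n3, n4}" for n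
    using that sfun_integral(1) unfolding fin_meas0_def by blast
  show ?thesis
    by (simp add: hp_op_def vint_iff_hp m hp_minus_functional[OF s s])
qed

text \<open>With L for \<open>levy_fun\<close> and C for the mean, the chain is e(A) L x = \<nu>(A)
  C x = C \<nu>(A) x = C e(A) y = e(A) C y. The first equality compares transforms, the second and
  fourth are commutation, the third is the definition of the graph; then e(A) is cancelled.\<close>

lemma cesaro_hp_func:
  assumes J: "commutes_with T J" and ab: "0 \<le> a" "0 \<le> b" and mu: "levy_measure \<mu>"
    and xy: "(x, y) \<in> hp_func T J (bernstein a b \<mu>)" and t: "0 < t"
  shows "cesaro T t y = hp (levy_fun a b \<mu> t) x"
proof -
  from xy obtain e1 e2 e3 e4 n1 n2 n3 n4 w
    where e: "cmeas (e1, e2, e3, e4)" and n: "cmeas (n1, n2, n3, n4)"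
      and lap: "\<And>z. 0 < Re z \<Longrightarrow>
        laplace (n1, n2, n3, n4) z = laplace (e1, e2, e3, e4) z * bernstein a b \<mu> z"
      and inj: "hp_injective T J (e1, e2, e3, e4)"
      and wn: "hp_op T J (n1, n2, n3, n4) x w" and we: "hp_op T J (e1, e2, e3, e4) y w"
    unfolding hp_func_def by auto
  define I where "I m m' P = (\<integral>s. P s \<partial>m) - (\<integral>s. P s \<partial>m')" for m m' :: "real measure" and P :: "real \<Rightarrow> real"
  define L where "L = levy_fun a b \<mu> t"
  define C where "C = mean_fun t"
  have sI: "\<exists>c. sfun c (I m m')" if "fin_meas0 m" "fin_meas0 m'" for m m'
    unfolding I_def using that sfun_minus[OF sfun_integral(1) sfun_integral(1)] unfolding fin_meas0_def by blast
  obtain ce cn ce' cn' where s: "sfun ce (I e1 e2)" "sfun ce' (I e3 e4)" "sfun cn (I n1 n2)" "sfun cn' (I n3 n4)"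
    using sI e n by (auto simp: cmeas_def) metis
  have L: "sfun (2 * rate a b \<mu> t) L" unfolding L_def by (rule sfun_levy[OF ab mu t])
  have C: "sfun 1 C" unfolding C_def by (rule sfun_mean[OF t])
  have trans: "I n1 n2 (\<lambda>s. exp (- (k * s))) = I e1 e2 (\<lambda>s. exp (- (k * s))) * bernstein_real a b \<mu> k"
    "I n3 n4 (\<lambda>s. exp (- (k * s))) = I e3 e4 (\<lambda>s. exp (- (k * s))) * bernstein_real a b \<mu> k"
    if "0 < k" for k
    using lap[of "of_real k"] that unfolding laplace_of_real bernstein_of_real I_def
    by (simp_all add: complex_eq_iff)
  have 1: "hp (I e1 e2) (hp L x) = hp (I n1 n2) (hp C x)"
    by (rule hp_prod_eq[OF s(1) L s(3) C]) (simp add: trans L_def C_def levy_lap mean_lap t mu)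
  have 2: "hp (I e3 e4) (hp L x) = hp (I n3 n4) (hp C x)"
    by (rule hp_prod_eq[OF s(2) L s(4) C]) (simp add: trans L_def C_def levy_lap mean_lap t mu)
  \<comment> \<open>J is only a real-linear operator here, so passing it through C rests on its
    commuting with the semigroup.\<close>
  have JC: "J (hp C u) = hp C (J u)" for u
  proof (rule hp_intertwine[OF C blinfun.bounded_linear_right, symmetric])
    fix s :: real assume "0 \<le> s"
    then have "T s o\<^sub>L J = J o\<^sub>L T s" using J by (simp add: commutes_with_def)
    then show "T s (J u) = J (T s u)" by (metis blinfun_apply_blinfun_compose)
  qed
  have "hp (I e1 e2) (hp L x) + J (hp (I e3 e4) (hp L x)) = hp C (hp (I n1 n2) x + J (hp (I n3 n4) x))"
    unfolding 1 2 hp_add[OF C] hp_commute[OF s(3) C] hp_commute[OF s(4) C] JC ..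
  also have "\<dots> = hp C (hp (I e1 e2) y + J (hp (I e3 e4) y))"
    using wn we by (simp add: hp_op_iff[OF e] hp_op_iff[OF n] I_def[abs_def])
  also have "\<dots> = hp (I e1 e2) (hp C y) + J (hp (I e3 e4) (hp C y))"
    unfolding hp_add[OF C] hp_commute[OF s(1) C] hp_commute[OF s(2) C] JC ..
  finally have "hp_op T J (e1, e2, e3, e4) (hp L x) (hp (I e1 e2) (hp C y) + J (hp (I e3 e4) (hp C y)))"
    unfolding hp_op_iff[OF e] I_def[abs_def] by (rule sym)
  moreover have "hp_op T J (e1, e2, e3, e4) (hp C y) (hp (I e1 e2) (hp C y) + J (hp (I e3 e4) (hp C y)))"
    unfolding hp_op_iff[OF e] I_def[abs_def] ..
  ultimately have "hp L x = hp C y"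
    using inj unfolding hp_injective_def by blast
  then show ?thesis by (simp add: L_def C_def hp_mean[OF t])
qed

section \<open>Kernel and range of the generator\<close>

lemma cesaro_tendsto: "((\<lambda>h. cesaro T h y) \<longlongrightarrow> y) (at_right 0)"
proof (rule tendstoI)
  fix \<epsilon> :: real assume "0 < \<epsilon>"
  then have "\<exists>d>0. \<forall>s\<in>{0..}. dist s 0 < d \<longrightarrow> dist (T s y) (T 0 y) < \<epsilon> / 2"
    using orbit_continuous[of y] unfolding continuous_on_iff by (metis atLeast_iff half_gt_zero order.refl)
  then obtain d where d: "0 < d" "\<And>s. 0 \<le> s \<Longrightarrow> s < d \<Longrightarrow> norm (T s y - y) < \<epsilon> / 2"
    by (auto simp: dist_norm T_zero)
  have "dist (cesaro T h y) y < \<epsilon>" if h: "0 < h" "h < d" for h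
  proof -
    have c: "continuous_on {0..h} (\<lambda>s. T s y)"
      by (rule continuous_on_subset[OF orbit_continuous]) auto
    have "integral {0..h} (\<lambda>s. T s y - y) = integral {0..h} (\<lambda>s. T s y) - h *\<^sub>R y"
      using h by (subst Henstock_Kurzweil_Integration.integral_diff) (auto intro: integrable_continuous_interval c)
    then have "cesaro T h y - y = (1 / h) *\<^sub>R integral {0..h} (\<lambda>s. T s y - y)"
      using h by (simp add: cesaro_def scaleR_diff_right)
    moreover have "norm (integral {0..h} (\<lambda>s. T s y - y)) \<le> \<epsilon> / 2 * (h - 0)"
      by (rule integral_bound) (use h d(2) c in \<open>auto intro!: continuous_intros less_imp_le\<close>)
    ultimately have "norm (cesaro T h y - y) \<le> \<epsilon> / 2"
      unfolding norm_scaleR using h by (simp add: field_simps)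
    then show ?thesis using \<open>0 < \<epsilon>\<close> by (simp add: dist_norm)
  qed
  then show "\<forall>\<^sub>F h in at_right 0. dist (cesaro T h y) y < \<epsilon>"
    using d(1) unfolding eventually_at_right_field by (metis)
qed

text \<open>The difference quotient at 0 tends to 0, so one step of length h moves u by at most
  \<delta> h. Cutting [0, s] into n such steps and bounding the semigroup by M gives a total
  displacement of at most M \<delta> s.\<close>

lemma negGen_kernel_fixed:
  assumes "(u, 0) \<in> negGen T" "0 \<le> s" shows "T s u = u"
proof -
  have "norm (T s u - u) \<le> 0 + \<epsilon>" if \<epsilon>: "0 < \<epsilon>" for \<epsilon>
  proof -
    define \<delta> where "\<delta> = \<epsilon> / ((M + 1) * (s + 1))"
    have \<delta>: "0 < \<delta>" using \<epsilon> M_nonneg assms(2) by (simp add: \<delta>_def)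
    have "((\<lambda>h. (1 / h) *\<^sub>R (T h u - u)) \<longlongrightarrow> 0) (at_right 0)" using assms(1) by (simp add: negGen_def)
    then have "\<forall>\<^sub>F h in at_right 0. norm ((1 / h) *\<^sub>R (T h u - u)) < \<delta>"
      using \<delta> by (simp add: tendsto_iff)
    then obtain d where d: "0 < d" "\<And>h. 0 < h \<Longrightarrow> h < d \<Longrightarrow> norm ((1 / h) *\<^sub>R (T h u - u)) < \<delta>"
      unfolding eventually_at_right_field by auto
    obtain n :: nat where n: "s / d < real n" using reals_Archimedean2 by blast
    have n0: "0 < n" using n assms(2) d(1) by (cases n) (auto simp: divide_less_0_iff)
    define h where "h = s / real n"
    have h: "0 \<le> h" "h < d" using n n0 d(1) assms(2) by (auto simp: h_def field_simps)
    have step: "norm (T h u - u) \<le> \<delta> * h"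
    proof (cases "h = 0")
      case False
      then show ?thesis using d(2)[of h] h unfolding norm_scaleR by (simp add: field_simps)
    qed (simp add: T_zero)
    have "norm (T (real k * h) u - u) \<le> real k * (M * (\<delta> * h))" for k
    proof (induction k)
      case (Suc k)
      have "T (real (Suc k) * h) u - u = T (real k * h) (T h u - u) + (T (real k * h) u - u)"
        using T_add[of "real k * h" h u] h by (simp add: algebra_simps blinfun.diff_right)
      then have "norm (T (real (Suc k) * h) u - u) \<le> norm (T (real k * h) (T h u - u)) + norm (T (real k * h) u - u)"
        using norm_triangle_ineq by metis
      also have "norm (T (real k * h) (T h u - u)) \<le> M * norm (T h u - u)"
        by (rule orbit_bound) (use h in simp)
      also have "\<dots> \<le> M * (\<delta> * h)" by (rule mult_left_mono[OF step M_nonneg])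
      finally show ?case using Suc.IH by (simp add: algebra_simps)
    qed (simp add: T_zero)
    from this[of n] have "norm (T s u - u) \<le> M * \<delta> * s" using n0 by (simp add: h_def)
    also have "\<dots> \<le> \<epsilon>"
    proof -
      have "M * s \<le> (M + 1) * (s + 1)" using M_nonneg assms(2) by (intro mult_mono) auto
      then have "\<delta> * (M * s) \<le> \<delta> * ((M + 1) * (s + 1))" using \<delta> by (intro mult_left_mono) auto
      also have "\<dots> = \<epsilon>" using M_nonneg assms(2) unfolding \<delta>_def by (intro nonzero_eq_divide_eq[THEN iffD1]) auto
      finally show ?thesis by (simp only: mult_ac)
    qed
    finally show ?thesis by simp
  qed
  then have "norm (T s u - u) \<le> 0" by (rule field_le_epsilon)
  then show ?thesis by simp
qed

text \<open>The orbit of u is constant, and for a = 0 only differences of values remain in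
  \<open>levy_fun\<close>, so it annihilates constants.\<close>

lemma hp_levy_kernel:
  assumes "(u, 0) \<in> negGen T" "0 \<le> b" "levy_measure \<mu>" "0 < t"
  shows "hp (levy_fun 0 b \<mu> t) u = 0"
proof (rule hp_eqI[OF sfun_levy])
  fix \<phi> :: "'a \<Rightarrow> real" assume \<phi>: "bounded_linear \<phi>"
  have "levy_fun 0 b \<mu> t (\<lambda>s. \<phi> (T s u)) = levy_fun 0 b \<mu> t (\<lambda>_. \<phi> u)"
    by (rule sfun_cong[OF sfun_levy bcont_orbit[OF \<phi>] bcont_const])
       (use assms negGen_kernel_fixed in auto)
  then show "\<phi> 0 = levy_fun 0 b \<mu> t (\<lambda>s. \<phi> (T s u))"
    by (simp add: levy_fun_def linear_0[OF bounded_linear.linear[OF \<phi>]])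
qed (use assms in auto)

lemma closure_range_negGen:
  assumes "v \<in> closure (op_ran (negGen T))" "0 < \<epsilon>"
  obtains h w where "0 < h" "norm (v - (w - T h w)) < \<epsilon>"
proof -
  obtain w v' where v': "(w, v') \<in> negGen T" "dist v' v < \<epsilon> / 2"
    using assms by (force simp: closure_approachable op_ran_def dest!: spec[of _ "\<epsilon> / 2"])
  have "((\<lambda>h. (1 / h) *\<^sub>R (T h w - w)) \<longlongrightarrow> - v') (at_right 0)" using v'(1) by (simp add: negGen_def)
  then have "\<forall>\<^sub>F h in at_right 0. dist ((1 / h) *\<^sub>R (T h w - w)) (- v') < \<epsilon> / 2"
    using assms(2) half_gt_zero unfolding tendsto_iff by blast
  then obtain d where d: "0 < d" "\<And>h. 0 < h \<Longrightarrow> h < d \<Longrightarrow> dist ((1 / h) *\<^sub>R (T h w - w)) (- v') < \<epsilon> / 2"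
    unfolding eventually_at_right_field by auto
  define h where "h = d / 2"
  have h: "0 < h" "h < d" using d(1) by (auto simp: h_def)
  \<comment> \<open>The difference quotient at w becomes a plain difference once the factor 1 / h is
    absorbed into the vector.\<close>
  define q where "q = (1 / h) *\<^sub>R w"
  have "v - (q - T h q) = (v - v') + ((1 / h) *\<^sub>R (T h w - w) - (- v'))"
    by (simp add: q_def blinfun.scaleR_right scaleR_diff_right)
  also have "norm \<dots> \<le> norm (v - v') + norm ((1 / h) *\<^sub>R (T h w - w) - (- v'))"
    by (rule norm_triangle_ineq)
  also have "\<dots> < \<epsilon>" using v'(2) d(2)[OF h] by (simp add: dist_norm norm_minus_commute)
  finally show ?thesis using h(1) that by blast
qed

text \<open>On \<open>w - T h w\<close> the increment in \<open>h\<close> can be traded for the Cesaro mean: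
  \<open>(1 - exp (- h k)) (1 - exp (- t k)) g(k) / (t k)\<close> is symmetric in \<open>h\<close> and \<open>t\<close> up to the factor \<open>h / t\<close>.\<close>

lemma hp_levy_difference_bound:
  assumes ab: "0 \<le> a" "0 \<le> b" and mu: "levy_measure \<mu>" and h: "0 < h"
  obtains K where "0 \<le> K" "\<And>t. 0 < t \<Longrightarrow> norm (hp (levy_fun a b \<mu> t) (w - T h w)) \<le> K / t"
proof
  \<comment> \<open>This vector is fixed before t, so the numerator of the final bound is uniform in
    t.\<close>
  define q where "q = hp (levy_fun a b \<mu> h) w"
  show "0 \<le> h * (norm q + M * norm q)" using h M_nonneg by simp
  fix t :: real assume t: "0 < t"
  have L: "sfun (2 * rate a b \<mu> t) (levy_fun a b \<mu> t)" if "0 < t" for t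
    by (rule sfun_levy[OF ab mu that])
  have D: "sfun 2 (\<lambda>P. P 0 - P t)" if "0 < t" for t by (rule sfun_difference) (use that in simp)
  have "hp (levy_fun a b \<mu> t) (w - T h w) = hp (levy_fun a b \<mu> t) (hp (\<lambda>P. P 0 - P h) w)"
    using h by (simp add: hp_difference)
  also have "\<dots> = hp (\<lambda>P. h / t * (P 0 - P t)) q"
    unfolding q_def
    by (rule hp_prod_eq[OF L[OF t] D[OF h] sfun_scale[OF D[OF t]] L[OF h]])
       (use t h in \<open>simp add: levy_lap mu mult_ac\<close>)
  also have "\<dots> = (h / t) *\<^sub>R (q - T t q)"
    by (simp only: hp_scale_functional[OF D[OF t]] hp_difference[OF less_imp_le[OF t]])
  finally show "norm (hp (levy_fun a b \<mu> t) (w - T h w)) \<le> h * (norm q + M * norm q) / t"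
    using order_trans[OF norm_triangle_ineq4 add_left_mono[OF orbit_bound], of t q q] t h
    by (simp add: divide_right_mono mult_left_mono)
qed

text \<open>With v = \<kappa>(A) x, comparing transforms gives v - T h v = h C_h y, because (1 - exp
  (- h k)) g(k) / k has both readings. Division by h and convergence of the means to y as h tends to
  0 identify y as the image of v.\<close>

lemma potential_in_negGen:
  assumes J: "commutes_with T J" and b: "0 \<le> b" and mu: "levy_measure \<mu>" "integrable \<mu> (\<lambda>s. s)"
    and xy: "(x, y) \<in> hp_func T J (bernstein 0 b \<mu>)"
  shows "(hp (potential_fun b \<mu>) x, y) \<in> negGen T"
proof -
  define v where "v = hp (potential_fun b \<mu>) x"
  obtain K where K: "sfun K (potential_fun b \<mu>)" using sfun_potential[OF mu] by blast
  have "(1 / h) *\<^sub>R (T h v - v) = - cesaro T h y" if h: "0 < h" for h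
  proof -
    have L: "sfun (2 * rate 0 b \<mu> h) (levy_fun 0 b \<mu> h)" by (rule sfun_levy[OF _ b mu(1) h]) simp
    have D: "sfun 2 (\<lambda>P. P 0 - P h)" by (rule sfun_difference) (use h in simp)
    \<comment> \<open>\<open>h * P 0\<close> is h times the point mass at 0, inserted to give the
      right-hand side the two-factor shape of \<open>hp_prod_eq\<close>.\<close>
    have "hp (\<lambda>P. P 0 - P h) v = hp (\<lambda>P. h * P 0) (hp (levy_fun 0 b \<mu> h) x)"
      unfolding v_def
      by (rule hp_prod_eq[OF D K sfun_scale[OF sfun_eval[of 0]] L])
         (use h in \<open>simp_all add: levy_lap potential_lap mu(1)\<close>)
    also have "\<dots> = h *\<^sub>R cesaro T h y"
      by (simp add: hp_scale_functional[OF sfun_eval[of 0]] hp_eval T_zero cesaro_hp_func[OF J _ b mu(1) xy h])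
    finally have "v - T h v = h *\<^sub>R cesaro T h y" using h by (simp add: hp_difference)
    then have "T h v - v = h *\<^sub>R (- cesaro T h y)" by (metis minus_diff_eq scaleR_minus_right)
    then show ?thesis using h by simp
  qed
  moreover have "((\<lambda>h. - cesaro T h y) \<longlongrightarrow> - y) (at_right 0)" by (rule tendsto_minus[OF cesaro_tendsto])
  ultimately have "((\<lambda>h. (1 / h) *\<^sub>R (T h v - v)) \<longlongrightarrow> - y) (at_right 0)"
    by (subst tendsto_cong[where g="\<lambda>h. - cesaro T h y"]) (auto simp: eventually_at_right_less intro: eventually_mono[OF eventually_at_right_less])
  then show ?thesis by (simp add: negGen_def v_def)
qed

end

lemma rate_nonneg:
  assumes "0 \<le> a" "0 \<le> b" "levy_measure \<mu>" "0 < t" shows "0 \<le> rate a b \<mu> t"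
  using sfun_nonneg[OF sfun_levy[OF assms]] by simp

text \<open>t r(t) is the sum of a t / 2, b and the integral of min s t, all nonnegative.
  Boundedness excludes a > 0, and monotone convergence of min s t to s yields the first
  moment.\<close>

lemma bounded_rate_imp:
  assumes ab: "0 \<le> a" "0 \<le> b" and mu: "levy_measure \<mu>"
    and bd: "\<And>t. t0 \<le> t \<Longrightarrow> t * rate a b \<mu> t \<le> c"
  shows "a = 0" "integrable \<mu> (\<lambda>s. s)"
proof -
  define t1 where "t1 = max t0 1"
  have nn: "0 \<le> (\<integral>s. min s t \<partial>\<mu>)" if "0 < t" for t
    by (rule Bochner_Integration.integral_nonneg) (use that levy_space[OF mu] in auto)
  have le: "a * t / 2 + b + (\<integral>s. min s t \<partial>\<mu>) \<le> c" if "t1 \<le> t" for t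
    using bd[of t] integral_min_rate[of t a b \<mu>] that by (simp add: t1_def)
  show "a = 0"
  proof (rule ccontr)
    assume "a \<noteq> 0"
    then have a: "0 < a" using ab by simp
    \<comment> \<open>The second argument forces a t / 2 to be at least c + 1; \<open>t1\<close>
      keeps t positive and within reach of the bound.\<close>
    define t where "t = max t1 (2 * (c + 1) / a)"
    have "t1 \<le> t" "0 < t" "2 * (c + 1) / a \<le> t" by (auto simp: t_def t1_def)
    then show False using le[of t] nn[of t] a ab by (simp add: field_simps)
  qed
  show "integrable \<mu> (\<lambda>s. s)"
  proof -
    define f where "f n s = min s (t1 + real n)" for n s
    have int: "integrable \<mu> (f n)" for n unfolding f_def
      by (rule levy_integrable_min[OF mu]) (simp add: t1_def)
    have inc: "incseq (\<lambda>n. \<integral>s. f n s \<partial>\<mu>)"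
      by (rule incseq_SucI, rule integral_mono[OF int int]) (simp add: f_def)
    have "(\<integral>s. f n s \<partial>\<mu>) \<le> c" for n
    proof -
      have "0 \<le> a * (t1 + real n) / 2" using ab by (simp add: t1_def)
      then show ?thesis using le[of "t1 + real n"] ab by (simp add: f_def)
    qed
    then obtain l where l: "(\<lambda>n. \<integral>s. f n s \<partial>\<mu>) \<longlonglongrightarrow> l"
      using incseq_convergent[OF inc] by blast
    show ?thesis
    proof (rule integrable_monotone_convergence[OF int _ _ l])
      show "AE s in \<mu>. mono (\<lambda>n. f n s)" by (auto simp: f_def mono_def)
      show "AE s in \<mu>. (\<lambda>n. f n s) \<longlonglongrightarrow> s"
      proof (rule AE_I2, rule tendsto_eventually)
        fix s
        have "\<forall>\<^sub>F n in sequentially. s \<le> real n"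
          by (rule eventually_sequentiallyI[of "nat \<lceil>s\<rceil>"]) linarith
        then show "\<forall>\<^sub>F n in sequentially. f n s = s"
          by eventually_elim (auto simp: f_def t1_def min_def)
      qed
      show "(\<lambda>s. s) \<in> borel_measurable \<mu>" by (rule levy_measurable[OF mu]) (rule continuous_on_id)
    qed
  qed
qed

theorem theorem3p3:
  fixes a b :: real and \<mu> :: "real measure"
    and T :: "real \<Rightarrow> ('a::banach \<Rightarrow>\<^sub>L 'a)" and J :: "'a \<Rightarrow>\<^sub>L 'a"
  assumes ab: "0 \<le> a" "0 \<le> b"
    and mu: "levy_measure \<mu>"
    and J: "complex_structure J"
    and T: "c0_semigroup T" "bounded_semigroup T" "commutes_with T J"
  defines "r \<equiv> rate a b \<mu>"
    and "M \<equiv> (SUP s\<in>{0..}. norm (T s))"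
    and "gA \<equiv> hp_func T J (bernstein a b \<mu>)"
  shows
    "(\<forall>x y. (x, y) \<in> gA \<longrightarrow> (\<forall>t>0. norm (cesaro T t y) \<le> 2 * M * r t * norm x))
     \<and>
     ((filterlim (\<lambda>t. t * r t) at_top at_top \<and> a = 0 \<and> mean_ergodic T) \<longrightarrow>
        (\<forall>y\<in>op_ran gA. (\<lambda>t. norm (cesaro T t y)) \<in> o[at_top](r)))
     \<and>
     ((\<lambda>t. t * r t) \<in> O[at_top](\<lambda>_. 1) \<longrightarrow>
        op_ran gA \<subseteq> op_ran (negGen T) \<and>
        (\<forall>y\<in>op_ran gA. (\<lambda>t. norm (cesaro T t y)) \<in> O[at_top](\<lambda>t. 1 / t)))"
proof -
  have "bdd_above ((\<lambda>s. norm (T s)) ` {0..})"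
    using T(2) by (auto simp: bounded_semigroup_def bdd_above_def)
  then have "norm (T s) \<le> M" if "0 \<le> s" for s
    unfolding M_def using that by (intro cSUP_upper) auto
  with T(1) interpret bounded_c0_semigroup T M by unfold_locales
  have cesaro: "cesaro T t y = hp (levy_fun a b \<mu> t) x" if "(x, y) \<in> gA" "0 < t" for x y t
    using cesaro_hp_func[OF T(3) ab mu] that by (simp add: gA_def)
  have L: "sfun (2 * r t) (levy_fun a b \<mu> t)" if "0 < t" for t
    unfolding r_def by (rule sfun_levy[OF ab mu that])
  have r0: "0 \<le> r t" if "0 < t" for t
    unfolding r_def by (rule rate_nonneg[OF ab mu that])
  have bound: "norm (cesaro T t y) \<le> 2 * M * r t * norm x" if "(x, y) \<in> gA" "0 < t" for x y t
    using norm_hp_le[OF L[OF that(2)], of x] by (simp add: cesaro[OF that] mult_ac)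
  have small: "(\<lambda>t. norm (cesaro T t y)) \<in> o[at_top](r)"
    if lim: "filterlim (\<lambda>t. t * r t) at_top at_top" and a: "a = 0" and erg: "mean_ergodic T"
      and y: "y \<in> op_ran gA" for y
  proof (rule landau_o.smallI)
    fix c :: real assume c: "0 < c"
    obtain x where x: "(x, y) \<in> gA" using y by (auto simp: op_ran_def)
    obtain u v where uv: "(u, 0) \<in> negGen T" "v \<in> closure (op_ran (negGen T))" "x = u + v"
      using erg unfolding mean_ergodic_def op_ker_def by blast
    \<comment> \<open>One half of c is reserved for the error in approximating v, the other for K /
      t; M + 1 keeps the denominator positive.\<close>
    define \<delta> where "\<delta> = c / (4 * (M + 1))"
    have \<delta>: "0 < \<delta>" "2 * M * \<delta> \<le> c / 2"
      using c M_nonneg by (auto simp: \<delta>_def field_simps)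
    obtain h w where hw: "0 < h" "norm (v - (w - T h w)) < \<delta>"
      by (rule closure_range_negGen[OF uv(2) \<delta>(1)])
    obtain K where K: "0 \<le> K" "\<And>t. 0 < t \<Longrightarrow> norm (hp (levy_fun a b \<mu> t) (w - T h w)) \<le> K / t"
      using hp_levy_difference_bound[OF ab mu hw(1), of w] by blast
    \<comment> \<open>The growth of t r(t) enters here: it makes K / t at most (c / 2) r(t).\<close>
    have "\<forall>\<^sub>F t in at_top. 2 * K / c \<le> t * r t" using lim by (simp add: filterlim_at_top)
    then show "\<forall>\<^sub>F t in at_top. norm (norm (cesaro T t y)) \<le> c * norm (r t)"
      using eventually_gt_at_top[of 0]
    proof eventually_elim
      case (elim t)
      have "cesaro T t y = hp (levy_fun a b \<mu> t) (v - (w - T h w)) + hp (levy_fun a b \<mu> t) (w - T h w)"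
        using hp_levy_kernel[OF uv(1) ab(2) mu elim(2)] hp_add[OF L[OF elim(2)], of u v]
          hp_diff[OF L[OF elim(2)], of v "w - T h w"]
        by (simp add: cesaro[OF x elim(2)] uv(3) a)
      then have "norm (cesaro T t y) \<le> norm (hp (levy_fun a b \<mu> t) (v - (w - T h w))) + K / t"
        using order_trans[OF norm_triangle_ineq add_left_mono[OF K(2)[OF elim(2)]]] by simp
      \<comment> \<open>The approximation error is already proportional to r(t), because the
        functional has variation at most 2 r(t); hence \<delta> could be fixed before t.\<close>
      also have "norm (hp (levy_fun a b \<mu> t) (v - (w - T h w))) \<le> 2 * r t * (M * \<delta>)"
        by (rule order_trans[OF norm_hp_le[OF L[OF elim(2)]]])
           (use r0[OF elim(2)] M_nonneg hw(2) in \<open>auto intro!: mult_left_mono\<close>)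
      also have "\<dots> \<le> c / 2 * r t" using mult_right_mono[OF \<delta>(2) r0[OF elim(2)]] by (simp add: mult_ac)
      also have "K / t \<le> c / 2 * r t" using elim c by (simp add: field_simps)
      finally show ?case using r0[OF elim(2)] by simp
    qed
  qed
  have big: "op_ran gA \<subseteq> op_ran (negGen T) \<and>
      (\<forall>y\<in>op_ran gA. (\<lambda>t. norm (cesaro T t y)) \<in> O[at_top](\<lambda>t. 1 / t))"
    if O: "(\<lambda>t. t * r t) \<in> O[at_top](\<lambda>_. 1)"
  proof -
    obtain c where c: "0 < c" "\<forall>\<^sub>F t in at_top. norm (t * r t) \<le> c"
      using O by (elim landau_o.bigE) auto
    obtain t0 where t0: "\<And>t. t0 \<le> t \<Longrightarrow> norm (t * r t) \<le> c"
      using c(2) by (auto simp: eventually_at_top_linorder)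
    have bd: "t * rate a b \<mu> t \<le> c" if "t0 \<le> t" for t
      using t0[OF that] by (simp add: r_def abs_le_iff)
    have a: "a = 0" by (rule bounded_rate_imp(1)[OF ab mu bd])
    have int: "integrable \<mu> (\<lambda>s. s)" by (rule bounded_rate_imp(2)[OF ab mu bd])
    have "op_ran gA \<subseteq> op_ran (negGen T)"
      using potential_in_negGen[OF T(3) ab(2) mu int] by (force simp: op_ran_def gA_def a)
    moreover have "(\<lambda>t. norm (cesaro T t y)) \<in> O[at_top](\<lambda>t. 1 / t)" if y: "y \<in> op_ran gA" for y
    proof -
      obtain x where x: "(x, y) \<in> gA" using y by (auto simp: op_ran_def)
      show ?thesis
      proof (rule bigoI)
        show "\<forall>\<^sub>F t in at_top. norm (norm (cesaro T t y)) \<le> (2 * M * c * norm x) * norm (1 / t)"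
          using eventually_gt_at_top[of 0] eventually_ge_at_top[of t0]
        proof eventually_elim
          case (elim t)
          \<comment> \<open>Inserted into the estimate of (a), this gives the decay 1 / t.\<close>
          have "r t \<le> c / t" using bd[OF elim(2)] elim(1) by (simp add: r_def field_simps)
          then have "2 * M * r t * norm x \<le> 2 * M * (c / t) * norm x"
            using M_nonneg by (intro mult_right_mono mult_left_mono) auto
          then show ?case using bound[OF x elim(1)] elim(1) by simp
        qed
      qed
    qed
    ultimately show ?thesis by blast
  qed
  show ?thesis using bound small big by blast
qed

end
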